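(* Let $p$ be a prime, $r,n$ positive integers, $q=p^r$, $d=\gcd(n+1,p-1)$ and $R=\gcd\left(\tfrac{p-1}{d},r\right)$. Let $\gamma$ be a primitive element of $\mathbb{F}_q$ (a generator of $\mathbb{F}_q^*$). Assume that $\mathbb{F}_q$ satisfies the following distinctness property: for all $a,b\in\mathbb{F}_q^*$, $$\mathrm{Kl}_n(q,a)=\mathrm{Kl}_n(q,b)\implies b=a^{p^s}\ \text{ for some } s\in\{0,1,\ldots,r-1\}.$$ Then: (1) For each $a\in\mathbb{F}_q^*$, the field $\mathbb{Q}(\mathrm{Kl}_n(q,a))$ is an intermediate field between $E_{dR}$ and $E_d$, i.e. $E_{dR}\subseteq \mathbb{Q}(\mathrm{Kl}_n(q,a))\subseteq E_d$. (2) For every positive divisor $e$ of $R$ with $e>1$ and every $a\in\mathbb{F}_q^*$, we have $\mathrm{Kl}_n(q,a)\in E_{de}$ if and only if there exist a positive divisor $t$ of $\tfrac{r}{e}$ and $u\in\{1,\ldots,e-1\}$ with $\gcd(e,u)=1$ such that $a\in \sqrt[e]{\gamma_t}^{\,u}\,\mathbb{F}_{p^t}^*$, where $$\sqrt[e]{\gamma_t}:=\gamma^{\frac{p^r-1}{e(p^t-1)}}$$ is an $e$th root of the primitive element $\gamma_t:=\gamma^{(p^r-1)/(p^t-1)}$ of $\mathbb{F}_{p^t}$.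
   Context: $\mathbb{F}_q$ is the finite field with $q=p^r$ elements, and for $t\mid r$, $\mathbb{F}_{p^t}$ is regarded as a subfield of $\mathbb{F}_q$. $\mathrm{Tr}:\mathbb{F}_q\to\mathbb{F}_p$ is the absolute trace, $\zeta_p=e^{2\pi \mathrm{i}/p}$, and $\psi(x)=\zeta_p^{\mathrm{Tr}(x)}$ for $x\in\mathbb{F}_q$. The $n$-dimensional Kloosterman sum at $a\in\mathbb{F}_q$ is $$\mathrm{Kl}_n(q,a)=\sum_{x_1,\ldots,x_n\in\mathbb{F}_q^*}\psi\left(x_1+x_2+\cdots+x_n+\frac{a}{x_1x_2\cdots x_n}\right)\in\mathbb{Q}(\zeta_p).$$ For a positive divisor $m$ of $p-1$, $E_m$ denotes the unique intermediate field $\mathbb{Q}\subseteq E_m\subseteq\mathbb{Q}(\zeta_p)$ of degree $\tfrac{p-1}{m}$ over $\mathbb{Q}$, i.e. the fixed field of the unique subgroup of order $m$ of the cyclic group $\mathrm{Gal}(\mathbb{Q}(\zeta_p)/\mathbb{Q})\cong\mathbb{F}_p^*$. *)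

theory Defs
  imports
    Complex_Main
    "HOL-Library.FuncSet"
    "HOL-Library.Cardinality"
    "HOL-Computational_Algebra.Primes"
    "HOL-Algebra.Generated_Fields"
    "HOL-Algebra.Embedded_Algebras"
    "HOL-Algebra.Algebraic_Closure_Type"
begin

text \<open>The finite field with $p^r$ elements is modelled by a type of classes \<open>field\<close> and
  \<open>finite\<close> with \<open>CARD('a) = p ^ r\<close>.  Subfields, generated fields and degrees are the notions of
  HOL-Algebra, applied to the record \<^const>\<open>ring_of_type_algebra\<close> of the type at hand.\<close>

definition primitive_element :: "'a::{field,finite} \<Rightarrow> bool" where
  "primitive_element g \<longleftrightarrow> range (\<lambda>k::nat. g ^ k) = UNIV - {0}"

text \<open>Meant for \<open>CARD('a) = p ^ r\<close> and \<open>t dvd r\<close>.\<close>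

definition finite_subfield :: "nat \<Rightarrow> nat \<Rightarrow> 'a::{field,finite} set" where
  "finite_subfield p t = (THE K. subfield K (ring_of_type_algebra :: 'a ring) \<and> card K = p ^ t)"

definition abs_trace :: "nat \<Rightarrow> nat \<Rightarrow> 'a::{field,finite} \<Rightarrow> 'a" where
  "abs_trace p r x = (\<Sum>i<r. x ^ (p ^ i))"

definition zeta :: "nat \<Rightarrow> complex" where
  "zeta p = exp (2 * of_real pi * \<i> / of_nat p)"

text \<open>The trace lies in the prime field, whose elements are \<open>of_nat k\<close> for a unique \<open>k < p\<close>; this
  \<open>k\<close> is the exponent of \<open>zeta p\<close>.\<close>

definition psi :: "nat \<Rightarrow> nat \<Rightarrow> 'a::{field,finite} \<Rightarrow> complex" where
  "psi p r x = zeta p ^ (THE k. k < p \<and> of_nat k = abs_trace p r x)"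

definition kloosterman :: "nat \<Rightarrow> nat \<Rightarrow> nat \<Rightarrow> 'a::{field,finite} \<Rightarrow> complex" where
  "kloosterman p r n a =
     (\<Sum>x \<in> {1..n} \<rightarrow>\<^sub>E (UNIV - {0}). psi p r ((\<Sum>i=1..n. x i) + a / (\<Prod>i=1..n. x i)))"

abbreviation complex_ring :: "complex ring" where
  "complex_ring \<equiv> ring_of_type_algebra"

text \<open>A generated field contains 1, hence the rationals: this is $\mathbb{Q}(z)$.\<close>

definition rat_adjoin :: "complex \<Rightarrow> complex set" where
  "rat_adjoin z = generate_field complex_ring {z}"

text \<open>Meant for prime \<open>p\<close> and \<open>m dvd p - 1\<close>; uniqueness holds because the Galois group of
  $\mathbb{Q}(\zeta_p)$ over the rationals is cyclic.\<close>

definition cyclotomic_subfield :: "nat \<Rightarrow> nat \<Rightarrow> complex set" where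
  "cyclotomic_subfield p m =
     (THE K. subfield K complex_ring \<and> K \<subseteq> rat_adjoin (zeta p) \<and>
             ring.dimension complex_ring ((p - 1) div m) \<rat> K)"

end

theory Submission
  imports Defs "HOL-Number_Theory.Pocklington"
begin

text \<open>
The proof transports the question from the Galois group of $\mathbb{Q}(\zeta_p)$ to the finite field.  Fix a
generator $g$ of the units modulo $p$ and let \<open>\<sigma> i\<close> be the automorphism $\zeta_p \mapsto \zeta_p^{g^i}$.
Replacing $\psi(x)$ by $\psi(cx)$ and substituting in the summation variables shows that \<open>\<sigma> i\<close> maps
$\mathrm{Kl}_n(q,a)$ to $\mathrm{Kl}_n(q,w^i a)$, where $w = g^{n+1}$ has order $M = (p-1)/d$ in
$\mathbb{F}_p^*$ (\<open>\<sigma>_kloosterman\<close>).  Kloosterman sums are also invariant under $a \mapsto a^p$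
(\<open>kloosterman_frobenius\<close>).  With the distinctness property this means: \<open>\<sigma> k\<close> fixes $\mathrm{Kl}_n(q,a)$
if and only if $w^k a = a^{p^s}$ for some $s$.

On the side of $\mathbb{Q}(\zeta_p)$ only the Galois correspondence of a cyclic group is needed.  Every
subfield is the fixed field \<open>Fix k\<close> of \<open>\<sigma> k\<close> for some divisor $k$ of $p-1$ (\<open>subfield_eq_Fix\<close>), and
\<open>Fix k\<close> has degree $k$ with the Gaussian periods as a basis (\<open>dimension_Fix\<close>).  Consequently $E_m$ is
\<open>Fix ((p - 1) div m)\<close> (\<open>cyclotomic_subfield_eq_Fix\<close>).  All this rests on the irreducibility of the
$p$-th cyclotomic polynomial, which follows from Eisenstein's criterion.

For the first part, $w^M = 1$ gives the upper bound $E_d$.  If $\mathbb{Q}(\mathrm{Kl}_n(q,a))$ is \<open>Fix k\<close>,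
then $w^k a = a^{p^s}$, and iterating this $r$ times gives $w^{kr} = 1$; thus $M$ divides $kr$, hence $kR$,
and \<open>Fix k\<close> contains \<open>Fix (M div R)\<close>, which is $E_{dR}$.

For the second part, $\mathrm{Kl}_n(q,a)$ lies in $E_{de}$ if and only if $\omega = w^{M/e}$, an element of order
$e$ in $\mathbb{F}_p^*$, satisfies $\omega a = a^{p^s}$ for some $s$.  That this describes the stated cosets is
a computation in the cyclic group generated by $\gamma$ (\<open>frobenius_quotient_iff_coset\<close>), in which $t$ is
the degree of $a^e$ over $\mathbb{F}_p$.
\<close>

section \<open>Subfields of a type of class field\<close>

lemma ring_of_type_algebra_simps [simp]:
  "carrier (ring_of_type_algebra :: 'a::comm_ring_1 ring) = UNIV"
  "monoid.mult (ring_of_type_algebra :: 'a ring) = (*)"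
  "monoid.one (ring_of_type_algebra :: 'a ring) = 1"
  "ring.zero (ring_of_type_algebra :: 'a ring) = 0"
  "ring.add (ring_of_type_algebra :: 'a ring) = (+)"
  by (simp_all add: ring_of_type_algebra_def)

lemma a_inv_ring_of_type_algebra [simp]:
  "a_inv (ring_of_type_algebra :: 'a::field ring) x = - x"
proof -
  interpret field "ring_of_type_algebra :: 'a ring" by (rule field_from_type_algebra)
  show ?thesis using minus_equality[of "- x" x] by simp
qed

lemma m_inv_ring_of_type_algebra [simp]:
  assumes "x \<noteq> 0"
  shows "m_inv (ring_of_type_algebra :: 'a::field ring) x = inverse x"
proof -
  interpret field "ring_of_type_algebra :: 'a ring" by (rule field_from_type_algebra)
  show ?thesis using comm_inv_char[of x "inverse x"] assms by simp
qed

text \<open>For the full ring of a type, being a subfield in the record-based sense is plain closure under the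
operations of the type, where \<open>inverse 0 = 0\<close>.\<close>

lemma subfield_ring_of_type_algebra_iff:
  "subfield K (ring_of_type_algebra :: 'a::field ring) \<longleftrightarrow>
     1 \<in> K \<and> (\<forall>x\<in>K. \<forall>y\<in>K. x + y \<in> K \<and> x * y \<in> K) \<and> (\<forall>x\<in>K. - x \<in> K \<and> inverse x \<in> K)"
  (is "?L \<longleftrightarrow> ?R")
proof -
  interpret field "ring_of_type_algebra :: 'a ring" by (rule field_from_type_algebra)
  show ?thesis
  proof
    assume K: ?L
    note S = subringE[OF subfieldE(1)[OF K], simplified]
    have "inverse x \<in> K" if "x \<in> K" for x
      using subfield_m_inv(1)[OF K, of x] that by (cases "x = 0") auto
    then show ?R using S by auto
  next
    assume R: ?R
    show ?L
      by (rule subfieldI', rule subringI) (use R in auto)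
  qed
qed

lemma generate_field_least:
  assumes "subfield K (ring_of_type_algebra :: 'a::field ring)" "z \<in> K"
  shows "generate_field (ring_of_type_algebra :: 'a ring) {z} \<subseteq> K"
proof -
  interpret field "ring_of_type_algebra :: 'a ring" by (rule field_from_type_algebra)
  show ?thesis using generate_field_min_subfield1[of "{z}" K] assms by simp
qed

lemma subfield_generate_field:
  "subfield (generate_field (ring_of_type_algebra :: 'a::field ring) H) ring_of_type_algebra"
proof -
  interpret field "ring_of_type_algebra :: 'a ring" by (rule field_from_type_algebra)
  show ?thesis by (rule generate_field_is_subfield) simp
qed

lemma subfield_sum:
  assumes "subfield K (ring_of_type_algebra :: 'a::field ring)" "\<And>x. x \<in> A \<Longrightarrow> f x \<in> K"
  shows "sum f A \<in> K"
proof -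
  note S = assms(1)[unfolded subfield_ring_of_type_algebra_iff]
  have "0 \<in> K" using S by (metis add.right_inverse)
  then show ?thesis using assms(2) S by (induction A rule: infinite_finite_induct) auto
qed

lemma Rats_subset_subfield:
  assumes "subfield K complex_ring"
  shows "\<rat> \<subseteq> K"
proof
  note S = assms[unfolded subfield_ring_of_type_algebra_iff]
  have 0: "0 \<in> K" using S by (metis add.right_inverse)
  have N: "of_nat n \<in> K" for n by (induction n) (use 0 S in auto)
  have Z: "of_int i \<in> K" for i by (cases i) (use N S in \<open>auto simp del: of_nat_Suc\<close>)
  fix x :: complex assume "x \<in> \<rat>"
  then obtain a b where "x = of_int a / of_int b" by (auto elim: Rats_cases')
  then show "x \<in> K" using Z S by (auto simp: divide_inverse)
qed

lemma subfield_Rats: "subfield \<rat> complex_ring"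
  by (auto simp: subfield_ring_of_type_algebra_iff)

interpretation complex_ring: ring complex_ring
  by (rule ring_from_type_algebra)

lemma combine_complex_ring:
  "length Ks = length Us \<Longrightarrow>
    complex_ring.combine Ks Us = (\<Sum>i<length Us. Ks ! i * Us ! i)"
  by (induction Ks Us rule: list_induct2) (simp_all only: complex_ring.combine.simps
      ring_of_type_algebra_simps length_Cons list.size(3) sum.lessThan_Suc_shift nth_Cons_0 nth_Cons_Suc, simp_all)

section \<open>Coefficientwise images of polynomials\<close>

text \<open>Evaluating integer and rational polynomials at a complex number goes through the coefficientwise
images under \<^term>\<open>of_int\<close> and \<^term>\<open>of_rat\<close>; the locale proves once that such an image is a ring
homomorphism.\<close>

locale coeff_hom =
  fixes c :: "'a::comm_ring_1 \<Rightarrow> 'b::comm_ring_1"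
  assumes c_add: "c (a + b) = c a + c b" and c_mult: "c (a * b) = c a * c b" and c_1: "c 1 = 1"
begin

lemma c_0: "c 0 = 0"
  using c_add[of 0 0] by simp

lemma map_poly_add_hom: "map_poly c (f + g) = map_poly c f + map_poly c g"
  by (rule poly_eqI) (simp add: coeff_map_poly c_0 c_add)

lemma c_minus: "c (- a) = - c a"
  using c_add[of "- a" a] by (simp add: c_0 eq_neg_iff_add_eq_0)

lemma c_diff: "c (a - b) = c a - c b"
  using c_add[of a "- b"] by (simp add: c_minus)

lemma map_poly_diff_hom: "map_poly c (f - g) = map_poly c f - map_poly c g"
  by (rule poly_eqI) (simp add: coeff_map_poly c_0 c_diff)

lemma map_poly_uminus_hom: "map_poly c (- f) = - map_poly c f"
  by (rule poly_eqI) (simp add: coeff_map_poly c_0 c_minus)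

lemma map_poly_smult_hom: "map_poly c (smult a f) = smult (c a) (map_poly c f)"
  by (rule poly_eqI) (simp add: coeff_map_poly c_0 c_mult)

lemma map_poly_pCons_hom: "map_poly c (pCons a f) = pCons (c a) (map_poly c f)"
  by (simp add: map_poly_pCons c_0)

lemma map_poly_mult_hom: "map_poly c (f * g) = map_poly c f * map_poly c g"
  by (induction f) (simp_all add: map_poly_add_hom map_poly_smult_hom map_poly_pCons_hom c_0)

lemma map_poly_monom_hom: "map_poly c (monom a n) = monom (c a) n"
  by (simp add: map_poly_monom c_0)

lemma map_poly_1_hom: "map_poly c 1 = 1"
  by (simp add: map_poly_1 c_1)

lemma map_poly_sum_hom: "map_poly c (sum f A) = (\<Sum>i\<in>A. map_poly c (f i))"
  by (induction A rule: infinite_finite_induct) (simp_all add: map_poly_add_hom)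

lemmas map_poly_hom =
  map_poly_add_hom map_poly_diff_hom map_poly_uminus_hom map_poly_smult_hom
  map_poly_pCons_hom map_poly_mult_hom
  map_poly_monom_hom map_poly_1_hom map_poly_sum_hom

end

global_interpretation int_coeff: coeff_hom "of_int :: int \<Rightarrow> complex"
  by standard simp_all

global_interpretation rat_coeff: coeff_hom "of_rat :: rat \<Rightarrow> complex"
  by standard (simp_all add: of_rat_add of_rat_mult)

global_interpretation int_rat_coeff: coeff_hom "of_int :: int \<Rightarrow> rat"
  by standard simp_all

declare int_coeff.map_poly_hom [simp] rat_coeff.map_poly_hom [simp] int_rat_coeff.map_poly_hom [simp]

section \<open>Irreducibility of the prime cyclotomic polynomial\<close>

text \<open>The first coefficient of $h$ not divisible by $p$, say the $i$-th, makes the $i$-th coefficient of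
$gh$ congruent to $g_0 h_i \not\equiv 0$ modulo $p$.  By hypothesis $i$ is then at least the degree of
$gh$, while $i \le \deg h$, and so nothing is left for the degree of $g$.\<close>

lemma eisenstein_one_side:
  fixes g h :: "int poly" and p :: int
  assumes p: "prime p" and lc: "\<not> p dvd lead_coeff (g * h)"
    and low: "\<And>i. i < degree (g * h) \<Longrightarrow> p dvd coeff (g * h) i"
    and g0: "\<not> p dvd coeff g 0"
  shows "degree g = 0"
proof -
  have ex: "\<not> p dvd coeff h (degree h)" using lc by (auto simp: lead_coeff_mult)
  then have nz: "g \<noteq> 0" "h \<noteq> 0" using g0 by auto
  define i where "i = (LEAST i. \<not> p dvd coeff h i)"
  have i: "\<not> p dvd coeff h i" unfolding i_def by (rule LeastI[of _ "degree h"]) (rule ex)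
  have i_le: "i \<le> degree h" unfolding i_def by (rule Least_le) (rule ex)
  have least: "p dvd coeff h j" if "j < i" for j
    using not_less_Least that unfolding i_def by blast
  have "coeff (g * h) i = (\<Sum>j\<le>i. coeff h j * coeff g (i - j))"
    by (simp add: mult.commute[of g] coeff_mult)
  also have "\<dots> = (\<Sum>j<i. coeff h j * coeff g (i - j)) + coeff h i * coeff g 0"
    by (simp add: lessThan_Suc_atMost[symmetric])
  finally have e: "coeff (g * h) i = (\<Sum>j<i. coeff h j * coeff g (i - j)) + coeff h i * coeff g 0" .
  have "p dvd (\<Sum>j<i. coeff h j * coeff g (i - j))" by (intro dvd_sum dvd_mult2) (use least in auto)
  moreover have "\<not> p dvd coeff h i * coeff g 0" using i g0 p by (simp add: prime_dvd_mult_iff)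
  ultimately have "\<not> p dvd coeff (g * h) i" unfolding e using dvd_add_right_iff by blast
  then have "\<not> i < degree (g * h)" using low by blast
  then show ?thesis using i_le nz by (simp add: degree_mult_eq)
qed

text \<open>As $p^2$ does not divide $g_0 h_0$, one of the two constant coefficients is prime to $p$.\<close>

lemma eisenstein:
  fixes g h :: "int poly" and p :: int
  assumes p: "prime p" and lc: "\<not> p dvd lead_coeff (g * h)"
    and low: "\<And>i. i < degree (g * h) \<Longrightarrow> p dvd coeff (g * h) i"
    and sq: "\<not> p\<^sup>2 dvd coeff (g * h) 0"
  shows "degree g = 0 \<or> degree h = 0"
proof (cases "p dvd coeff g 0")
  case True
  have "\<not> p dvd coeff h 0"
  proof
    assume "p dvd coeff h 0"
    then have "p\<^sup>2 dvd coeff (g * h) 0"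
      using True by (simp add: coeff_mult power2_eq_square mult_dvd_mono)
    then show False using sq by simp
  qed
  then show ?thesis using eisenstein_one_side[of p h g] assms by (simp add: mult.commute)
qed (use eisenstein_one_side[of p g h] assms in auto)

abbreviation int_eval :: "int poly \<Rightarrow> complex \<Rightarrow> complex" where
  "int_eval f x \<equiv> poly (map_poly of_int f) x"

abbreviation rat_eval :: "rat poly \<Rightarrow> complex \<Rightarrow> complex" where
  "rat_eval f x \<equiv> poly (map_poly of_rat f) x"

text \<open>An instance of Gauss's lemma: a primitive integer polynomial $h$ of least degree with root $x$ divides
a multiple of $f$ by pseudo-division, and comparing primitive parts turns this into a factorization
$f = \pm h h'$ over the integers.  Irreducibility leaves no room for a non-constant $h'$.\<close>

lemma degree_le_of_irreducible_root:
  fixes f g :: "int poly" and x :: complex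
  assumes irr: "\<And>g h. f = g * h \<Longrightarrow> degree g = 0 \<or> degree h = 0"
    and cont: "content f = 1" and f: "int_eval f x = 0"
    and g: "g \<noteq> 0" "int_eval g x = 0"
  shows "degree f \<le> degree g"
proof -
  let ?P = "\<lambda>h. h \<noteq> 0 \<and> int_eval h x = 0"
  define h0 where "h0 = arg_min degree ?P"
  have h0: "?P h0" and least: "\<And>h. ?P h \<Longrightarrow> degree h0 \<le> degree h"
    using arg_min_natI[of ?P g degree] arg_min_nat_le[of ?P _ degree] g unfolding h0_def by auto
  define h where "h = primitive_part h0"
  have "map_poly of_int h0 = smult (of_int (content h0)) (map_poly of_int h :: complex poly)"
    unfolding h_def by (metis content_times_primitive_part int_coeff.map_poly_smult_hom)
  then have h: "h \<noteq> 0" "int_eval h x = 0" "degree h = degree h0" "primitive_part h = h"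
    using h0 by (auto simp: h_def primitive_part_prim)
  obtain q r where qr: "pseudo_divmod f h = (q, r)" by fastforce
  define a where "a = lead_coeff h ^ (Suc (degree f) - degree h)"
  have a0: "a \<noteq> 0" using h(1) by (simp add: a_def)
  \<comment> \<open>The remainder vanishes at $x$, and by minimality of the degree of $h$ it is zero.\<close>
  have af: "smult a f = h * q + r" and r: "r = 0 \<or> degree r < degree h"
    using pseudo_divmod[OF h(1) qr] by (simp_all add: a_def)
  have "int_eval r x = 0"
    using arg_cong[OF af, of "\<lambda>u. int_eval u x"] f h(2) by simp
  then have "r = 0" using least[of r] r h(3) by fastforce
  then have "smult a f = h * q" using af by simp
  then have "smult (unit_factor a) (primitive_part f) = primitive_part h * primitive_part q"
    by (metis primitive_part_mult primitive_part_smult)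
  then have "smult (sgn a) f = h * primitive_part q"
    using h(4) primitive_part_prim[OF cont] by simp
  then have "smult (sgn a * sgn a) f = h * smult (sgn a) (primitive_part q)"
    by (metis mult_smult_right smult_smult)
  moreover have "sgn a * sgn a = 1" using a0 by (simp add: sgn_if)
  ultimately have fh: "f = h * smult (sgn a) (primitive_part q)" by simp
  have "degree h \<noteq> 0"
  proof
    assume "degree h = 0"
    then obtain b where "h = [:b:]" by (metis degree_eq_zeroE)
    then show False using h by simp
  qed
  then have "degree (smult (sgn a) (primitive_part q)) = 0" using irr[OF fh] by argo
  then have "degree f \<le> degree h" using fh degree_mult_le[of h "smult (sgn a) (primitive_part q)"]
    by simp
  then show ?thesis using least[of g] g h(3) by linarith
qed

lemma zeta_power: "zeta p ^ k = cis (2 * pi * real k / real p)"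
  by (simp add: zeta_def cis_conv_exp flip: exp_of_nat_mult) (simp add: mult_ac)

lemma zeta_power_eq_1_iff:
  assumes "p > 0"
  shows "zeta p ^ k = 1 \<longleftrightarrow> p dvd k"
proof -
  have p1: "zeta p ^ p = 1" using assms by (simp add: zeta_power)
  have "zeta p ^ k = zeta p ^ (p * (k div p) + k mod p)" by simp
  also have "\<dots> = zeta p ^ (k mod p)" by (simp only: power_add power_mult p1) simp
  finally have m: "zeta p ^ k = zeta p ^ (k mod p)" .
  have "inj_on (\<lambda>k. zeta p ^ k) {..<p}"
    using bij_betw_roots_unity[OF assms] by (simp add: zeta_power bij_betw_def)
  then have "zeta p ^ (k mod p) = zeta p ^ 0 \<longleftrightarrow> k mod p = 0"
    using assms by (intro inj_on_eq_iff) auto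
  then show ?thesis using m by (simp add: dvd_eq_mod_eq_0)
qed

text \<open>In the variable $y = X - 1$ the cyclotomic polynomial is $((y+1)^p - 1)/y$, whose coefficients are the
binomial coefficients $\binom{p}{i+1}$.  Eisenstein's criterion applies to it, so no nonzero integer
polynomial of smaller degree vanishes at $\zeta_p - 1$; shifting back gives the claim for $\zeta_p$.\<close>

lemma degree_int_poly_zeta_root:
  assumes p: "prime p" and g: "g \<noteq> 0" "int_eval g (zeta p) = 0"
  shows "p - 1 \<le> degree g"
proof -
  define F :: "int poly" where "F = (\<Sum>i<p. monom (int (p choose Suc i)) i)"
  have cF: "coeff F i = (if i < p then int (p choose Suc i) else 0)" for i
    by (simp add: F_def coeff_sum)
  have p1: "p > 1" using p prime_gt_1_nat by blast
  have degF: "degree F = p - 1"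
  proof (rule antisym)
    show "degree F \<le> p - 1" by (rule degree_le) (use p1 in \<open>auto simp: cF\<close>)
    show "p - 1 \<le> degree F" by (rule le_degree) (use p1 in \<open>auto simp: cF\<close>)
  qed
  have lcF: "lead_coeff F = 1" using p1 by (simp add: degF cF)
  define y where "y = zeta p - 1"
  have y0: "y \<noteq> 0" using zeta_power_eq_1_iff[of p 1] p1 by (auto simp: y_def)
  have evF: "int_eval F y = (\<Sum>i<p. of_nat (p choose Suc i) * y ^ i)"
    by (simp add: F_def poly_sum poly_monom)
  have "(y + 1) ^ p = (\<Sum>i\<le>p. of_nat (p choose i) * y ^ i)"
    by (simp add: binomial_ring)
  also have "\<dots> = 1 + (\<Sum>i<p. of_nat (p choose Suc i) * y ^ Suc i)"
    by (subst lessThan_Suc_atMost[symmetric], subst sum.lessThan_Suc_shift) simp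
  also have "\<dots> = 1 + y * int_eval F y"
    by (simp add: evF sum_distrib_left mult_ac)
  finally have "y * int_eval F y = 0" using zeta_power_eq_1_iff[of p p] p1 by (simp add: y_def)
  then have F0: "int_eval F y = 0" using y0 by simp
  have contF: "content F = 1"
  proof -
    have "content F dvd 1" by (metis content_dvd_coeff lcF)
    then have "normalize (content F) = 1" by simp
    then show ?thesis by (simp only: normalize_content)
  qed
  have irrF: "degree g = 0 \<or> degree h = 0" if "F = g * h" for g h
  proof (rule eisenstein[of "int p"])
    show "prime (int p)" using p by simp
    show "\<not> int p dvd lead_coeff (g * h)" using lcF p1 that by simp
    show "int p dvd coeff (g * h) i" if "i < degree (g * h)" for i
      using that p1 \<open>F = g * h\<close>[symmetric] by (auto simp: degF cF intro!: dvd_choose_prime p)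
    show "\<not> (int p)\<^sup>2 dvd coeff (g * h) 0"
    proof
      assume "(int p)\<^sup>2 dvd coeff (g * h) 0"
      then have "int p * int p dvd int p" using p1 that[symmetric] by (simp add: cF power2_eq_square)
      then show False using p1 by (simp flip: of_nat_mult)
    qed
  qed
  let ?G = "pcompose g [:1, 1:]"
  have "int_eval ?G y = int_eval g (zeta p)"
    by (induction g) (simp_all add: pcompose_pCons y_def algebra_simps)
  moreover have "?G \<noteq> 0" using g(1) by (simp add: pcompose_eq_0_iff)
  moreover have "degree ?G = degree g" by (simp add: degree_pcompose)
  ultimately show ?thesis
    using degree_le_of_irreducible_root[OF irrF contF F0, of ?G] g degF by simp
qed

lemma clear_denominators:
  fixes f :: "rat poly"
  obtains a :: int and F :: "int poly" where "a \<noteq> 0" "smult (of_int a) f = map_poly of_int F"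
proof -
  have "\<exists>a F. a \<noteq> 0 \<and> smult (of_int a) f = map_poly of_int F"
  proof (induction f)
    case 0
    show ?case by (intro exI[of _ 1] exI[of _ 0]) simp
  next
    case (pCons b f)
    then obtain a F where aF: "a \<noteq> 0" "smult (of_int a) f = map_poly of_int F" by auto
    obtain m n where mn: "b = of_int m / of_int n" "n \<noteq> 0"
      by (metis Rat_cases_nonzero Fract_of_int_quotient quotient_of_div quotient_of_denom_pos' less_irrefl prod.collapse)
    have "smult (of_int n) (smult (of_int a) f) = map_poly of_int (smult n F)"
      by (simp only: aF(2) int_rat_coeff.map_poly_smult_hom)
    then have "smult (of_int (a * n)) (pCons b f) = map_poly of_int (pCons (a * m) (smult n F))"
      using mn by (simp add: mult_ac)
    moreover have "a * n \<noteq> 0" using aF mn by simp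
    ultimately show ?case by blast
  qed
  then show thesis using that by blast
qed

lemma rat_poly_zeta_root_eq_0:
  assumes p: "prime p" and f: "rat_eval f (zeta p) = 0" "degree f < p - 1"
  shows "f = 0"
proof (rule ccontr)
  assume "f \<noteq> 0"
  obtain a F where aF: "a \<noteq> 0" "smult (of_int a) f = map_poly of_int F"
    by (rule clear_denominators)
  have "map_poly of_rat (map_poly of_int F :: rat poly) = (map_poly of_int F :: complex poly)"
    by (simp add: map_poly_map_poly o_def)
  then have "int_eval F (zeta p) = rat_eval (smult (of_int a) f) (zeta p)" by (simp only: aF)
  also have "\<dots> = 0" using f by simp
  finally have "int_eval F (zeta p) = 0" .
  moreover have "degree F = degree f"
    using arg_cong[OF aF(2), of degree] aF(1) by (simp add: degree_map_poly)
  moreover have "F \<noteq> 0" using aF \<open>f \<noteq> 0\<close> by auto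
  ultimately show False using degree_int_poly_zeta_root[OF p, of F] f(2) by simp
qed

text \<open>With this polynomial, which does not depend on $x$, the conjugation $\zeta_p \mapsto \zeta_p^c$ turns
into a substitution in polynomials.  So conjugations compose as expected and preserve the field.\<close>

lemma rat_eval_compose_power: "\<exists>h. \<forall>x. rat_eval f (x ^ c) = rat_eval h x"
proof -
  have "rat_eval (pcompose f (monom 1 c)) x = rat_eval f (x ^ c)" for x
    by (induction f) (simp_all add: pcompose_pCons poly_monom)
  then show ?thesis by metis
qed

section \<open>The Galois group of the prime cyclotomic field\<close>

text \<open>The group of units modulo $p$ is cyclic.  Fixing a generator $g$ replaces every subgroup of the Galois
group of $\mathbb{Q}(\zeta_p)$ by a divisor of $p-1$, and cosets by residues of exponents.\<close>

locale prime_cyclotomic =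
  fixes p g :: nat
  assumes prime_p: "prime p"
    and generator: "\<And>i. [g ^ i = 1] (mod p) \<longleftrightarrow> (p - 1) dvd i"
begin

abbreviation \<zeta> :: complex where "\<zeta> \<equiv> zeta p"

text \<open>The field $\mathbb{Q}(\zeta_p)$, as the image of polynomial evaluation; this form gives direct access to
the Galois action.  It agrees with \<^term>\<open>rat_adjoin\<close> by \<open>rat_adjoin_zeta\<close> below.\<close>

definition L :: "complex set" where "L = range (\<lambda>f. rat_eval f \<zeta>)"

text \<open>The automorphism $\zeta_p \mapsto \zeta_p^{g^i}$, so that \<open>\<sigma> i\<close> is the $i$-th power of a generator of
the Galois group.  The value does not depend on the chosen polynomial: see \<open>\<sigma>_rat_eval\<close>.\<close>

definition \<sigma> :: "nat \<Rightarrow> complex \<Rightarrow> complex" where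
  "\<sigma> i z = rat_eval (SOME f. rat_eval f \<zeta> = z) (\<zeta> ^ (g ^ i))"

lemma p_gt_1: "p > 1"
  using prime_p prime_gt_1_nat by blast

lemma zeta_power_cong: "[i = j] (mod p) \<Longrightarrow> \<zeta> ^ i = \<zeta> ^ j"
proof -
  assume ij: "[i = j] (mod p)"
  have m: "\<zeta> ^ k = \<zeta> ^ (k mod p)" for k
  proof -
    have "\<zeta> ^ p = 1" using zeta_power_eq_1_iff[of p p] p_gt_1 by simp
    then have "\<zeta> ^ (p * (k div p) + k mod p) = \<zeta> ^ (k mod p)"
      by (simp only: power_add power_mult) simp
    then show ?thesis by simp
  qed
  show ?thesis using m[of i] m[of j] ij by (simp add: cong_def)
qed

lemma generator_power_not_dvd: "\<not> p dvd g ^ i"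
proof
  assume "p dvd g ^ i"
  then have "p dvd g" by (rule prime_dvd_power[OF prime_p])
  then have "p dvd g ^ (p - 1)" using p_gt_1 by (subst prime_dvd_power_iff[OF prime_p]) simp_all
  moreover have "[g ^ (p - 1) = 1] (mod p)" using generator[of "p - 1"] by simp
  ultimately have "p dvd 1" using cong_dvd_iff by blast
  then show False using p_gt_1 by simp
qed

text \<open>The remainder of $f$ modulo $1 + X + \dots + X^{p-1}$ has degree below $p - 1$ and vanishes at $\zeta_p$, so
it is zero by irreducibility.  Hence $f$ is a multiple of that polynomial, which vanishes at all the
conjugates.\<close>

lemma rat_eval_zeta_eq_0_conjugate:
  assumes f: "rat_eval f \<zeta> = 0" and c: "\<not> p dvd c"
  shows "rat_eval f (\<zeta> ^ c) = 0"
proof -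
  define \<Phi> :: "rat poly" where "\<Phi> = (\<Sum>i<p. monom 1 i)"
  have c\<Phi>: "coeff \<Phi> i = (if i < p then 1 else 0)" for i by (simp add: \<Phi>_def coeff_sum)
  have deg: "degree \<Phi> = p - 1"
  proof (rule antisym)
    show "degree \<Phi> \<le> p - 1" by (rule degree_le) (use p_gt_1 in \<open>auto simp: c\<Phi>\<close>)
    show "p - 1 \<le> degree \<Phi>" by (rule le_degree) (use p_gt_1 in \<open>auto simp: c\<Phi>\<close>)
  qed
  have \<Phi>0: "rat_eval \<Phi> (\<zeta> ^ d) = 0" if "\<not> p dvd d" for d
  proof -
    have "rat_eval \<Phi> (\<zeta> ^ d) = (\<Sum>i<p. (\<zeta> ^ d) ^ i)" by (simp add: \<Phi>_def poly_sum poly_monom)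
    moreover have "\<zeta> ^ d \<noteq> 1" using that zeta_power_eq_1_iff p_gt_1 by simp
    moreover have "(\<zeta> ^ d) ^ p = 1"
      using zeta_power_eq_1_iff[of p "d * p"] p_gt_1 by (simp add: power_mult)
    ultimately show ?thesis using geometric_sum[of "\<zeta> ^ d" p] by simp
  qed
  have split: "rat_eval f x = rat_eval (f div \<Phi>) x * rat_eval \<Phi> x + rat_eval (f mod \<Phi>) x" for x
    using arg_cong[OF div_mult_mod_eq[of f \<Phi>, symmetric], of "\<lambda>u. rat_eval u x"]
    by (simp only: rat_coeff.map_poly_hom poly_add poly_mult)
  have "rat_eval (f mod \<Phi>) \<zeta> = 0" using split[of \<zeta>] f \<Phi>0[of 1] p_gt_1 by simp
  moreover have "f mod \<Phi> = 0 \<or> degree (f mod \<Phi>) < p - 1"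
    using degree_mod_less[of \<Phi> f] deg p_gt_1 by fastforce
  ultimately have "f mod \<Phi> = 0" using rat_poly_zeta_root_eq_0[OF prime_p] by blast
  then show ?thesis using split[of "\<zeta> ^ c"] \<Phi>0[OF c] by simp
qed

lemma \<sigma>_rat_eval: "\<sigma> i (rat_eval f \<zeta>) = rat_eval f (\<zeta> ^ (g ^ i))"
proof -
  define h where "h = (SOME h. rat_eval h \<zeta> = rat_eval f \<zeta>)"
  have "rat_eval h \<zeta> = rat_eval f \<zeta>" unfolding h_def by (rule someI[of _ f]) simp
  then have "rat_eval (h - f) \<zeta> = 0" by simp
  from rat_eval_zeta_eq_0_conjugate[OF this generator_power_not_dvd, of i]
  show ?thesis by (simp add: \<sigma>_def h_def)
qed

lemma rat_eval_in_L [simp]: "rat_eval f \<zeta> \<in> L"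
  by (simp add: L_def)

lemma in_L_E:
  assumes "z \<in> L"
  obtains f where "z = rat_eval f \<zeta>"
  using assms by (auto simp: L_def)

lemma L_closed_unary [simp]:
  assumes "x \<in> L"
  shows "- x \<in> L" "\<sigma> i x \<in> L"
proof -
  obtain f where f: "x = rat_eval f \<zeta>" by (rule in_L_E[OF assms])
  have "- x = rat_eval (- f) \<zeta>" by (simp add: f)
  then show "- x \<in> L" by (simp only: rat_eval_in_L)
  show "\<sigma> i x \<in> L"
    using rat_eval_compose_power[of f "g ^ i"] by (auto simp: f \<sigma>_rat_eval)
qed

lemma L_closed_binary [simp]:
  assumes "x \<in> L" "y \<in> L"
  shows "x + y \<in> L" "x * y \<in> L" "x - y \<in> L"
proof -
  obtain f where f: "x = rat_eval f \<zeta>" by (rule in_L_E[OF assms(1)])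
  obtain h where h: "y = rat_eval h \<zeta>" by (rule in_L_E[OF assms(2)])
  have "x + y = rat_eval (f + h) \<zeta>" "x * y = rat_eval (f * h) \<zeta>"
    "x - y = rat_eval (f - h) \<zeta>"
    by (simp_all add: f h)
  then show "x + y \<in> L" "x * y \<in> L" "x - y \<in> L" by (simp_all only: rat_eval_in_L)
qed

lemma of_rat_in_L [simp]: "of_rat a \<in> L"
  using rat_eval_in_L[of "[:a:]"] by (simp del: rat_eval_in_L)

lemma Rats_in_L: "x \<in> \<rat> \<Longrightarrow> x \<in> L"
  by (auto elim: Rats_cases)

lemma L_0 [simp]: "0 \<in> L" and L_1 [simp]: "1 \<in> L"
  using of_rat_in_L[of 0] of_rat_in_L[of 1] by simp_all

lemma zeta_power_in_L [simp]: "\<zeta> ^ k \<in> L"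
  using rat_eval_in_L[of "monom 1 k"] by (simp add: poly_monom del: rat_eval_in_L)

lemma L_sum: "(\<And>x. x \<in> A \<Longrightarrow> f x \<in> L) \<Longrightarrow> sum f A \<in> L"
  by (induction A rule: infinite_finite_induct) auto

lemma \<sigma>_add: "x \<in> L \<Longrightarrow> y \<in> L \<Longrightarrow> \<sigma> i (x + y) = \<sigma> i x + \<sigma> i y"
  using \<sigma>_rat_eval[of i "_ + _"] by (auto elim!: in_L_E simp: \<sigma>_rat_eval)

lemma \<sigma>_mult: "x \<in> L \<Longrightarrow> y \<in> L \<Longrightarrow> \<sigma> i (x * y) = \<sigma> i x * \<sigma> i y"
  using \<sigma>_rat_eval[of i "_ * _"] by (auto elim!: in_L_E simp: \<sigma>_rat_eval)

lemma \<sigma>_of_rat [simp]: "\<sigma> i (of_rat a) = of_rat a"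
  using \<sigma>_rat_eval[of i "[:a:]"] by simp

lemma \<sigma>_0_1 [simp]: "\<sigma> i 0 = 0" "\<sigma> i 1 = 1"
  using \<sigma>_of_rat[of i 0] \<sigma>_of_rat[of i 1] by simp_all

lemma \<sigma>_minus: "x \<in> L \<Longrightarrow> \<sigma> i (- x) = - \<sigma> i x"
  using \<sigma>_add[of x "- x" i] by (simp add: eq_neg_iff_add_eq_0 add.commute)

lemma \<sigma>_diff: "x \<in> L \<Longrightarrow> y \<in> L \<Longrightarrow> \<sigma> i (x - y) = \<sigma> i x - \<sigma> i y"
  using \<sigma>_add[of x "- y" i] by (simp add: \<sigma>_minus)

lemma \<sigma>_sum: "(\<And>x. x \<in> A \<Longrightarrow> f x \<in> L) \<Longrightarrow> \<sigma> i (sum f A) = (\<Sum>x\<in>A. \<sigma> i (f x))"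
  by (induction A rule: infinite_finite_induct) (auto simp: \<sigma>_add L_sum)

lemma \<sigma>_zeta_power: "\<sigma> i (\<zeta> ^ k) = \<zeta> ^ (g ^ i * k)"
  using \<sigma>_rat_eval[of i "monom 1 k"] by (simp add: poly_monom power_mult)

lemma \<sigma>_\<sigma>:
  assumes "z \<in> L"
  shows "\<sigma> i (\<sigma> j z) = \<sigma> (i + j) z"
proof -
  obtain f where f: "z = rat_eval f \<zeta>" by (rule in_L_E[OF assms])
  obtain h where h: "\<And>x. rat_eval f (x ^ (g ^ j)) = rat_eval h x"
    using rat_eval_compose_power[of f "g ^ j"] by blast
  have "\<sigma> i (\<sigma> j z) = rat_eval h (\<zeta> ^ (g ^ i))" by (simp add: f \<sigma>_rat_eval h)
  also have "\<dots> = \<sigma> (i + j) z" by (simp add: f \<sigma>_rat_eval power_add power_mult h)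
  finally show ?thesis .
qed

lemma \<sigma>_multiple_of_order:
  assumes z: "z \<in> L" and i: "(p - 1) dvd i"
  shows "\<sigma> i z = z"
proof -
  obtain f where f: "z = rat_eval f \<zeta>" by (rule in_L_E[OF z])
  have "\<zeta> ^ (g ^ i) = \<zeta>" using zeta_power_cong[of "g ^ i" 1] generator i by simp
  then show ?thesis by (simp add: f \<sigma>_rat_eval)
qed

lemma \<sigma>_cong:
  assumes z: "z \<in> L" and ij: "[i = j] (mod p - 1)"
  shows "\<sigma> i z = \<sigma> j z"
proof -
  have m: "\<sigma> k z = \<sigma> (k mod (p - 1)) z" for k
  proof -
    have "\<sigma> (k mod (p - 1)) (\<sigma> ((p - 1) * (k div (p - 1))) z) = \<sigma> k z" using z by (simp add: \<sigma>_\<sigma>)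
    then show ?thesis using \<sigma>_multiple_of_order[OF z, of "(p - 1) * (k div (p - 1))"] by simp
  qed
  show ?thesis using m[of i] m[of j] ij by (simp add: cong_def)
qed

lemma \<sigma>_inverse_exists: "\<exists>j. \<forall>z\<in>L. \<sigma> j (\<sigma> i z) = z \<and> \<sigma> i (\<sigma> j z) = z"
proof (intro exI ballI)
  fix z assume "z \<in> L"
  have "1 * i \<le> (p - 1) * i" using p_gt_1 by (intro mult_right_mono) auto
  then have "i \<le> (p - 1) * i" by simp
  then show "\<sigma> ((p - 1) * i - i) (\<sigma> i z) = z \<and> \<sigma> i (\<sigma> ((p - 1) * i - i) z) = z"
    using \<sigma>_multiple_of_order[OF \<open>z \<in> L\<close>, of "(p - 1) * i"] \<open>z \<in> L\<close> by (simp add: \<sigma>_\<sigma>)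
qed

lemma \<sigma>_eq_0_iff: "z \<in> L \<Longrightarrow> \<sigma> i z = 0 \<longleftrightarrow> z = 0"
  using \<sigma>_inverse_exists[of i] by (metis \<sigma>_0_1(1))

lemma generator_residues:
  "bij_betw (\<lambda>i. g ^ i mod p) {..<p - 1} {1..<p}"
proof -
  have inj: "inj_on (\<lambda>i. g ^ i mod p) {..<p - 1}"
  proof (rule linorder_inj_onI)
    fix i j assume ij: "i < j" "i \<in> {..<p - 1}" "j \<in> {..<p - 1}"
    have "\<not> [g ^ i = g ^ j] (mod p)"
    proof
      assume "[g ^ i = g ^ j] (mod p)"
      then have "[g ^ i * 1 = g ^ i * g ^ (j - i)] (mod p)" using ij by (simp flip: power_add)
      moreover have "coprime (g ^ i) p"
        using generator_power_not_dvd prime_imp_coprime[OF prime_p] coprime_commute by blast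
      ultimately have "[1 = g ^ (j - i)] (mod p)" using cong_mult_lcancel_nat by blast
      then have "(p - 1) dvd (j - i)" using generator cong_sym by blast
      then show False using ij dvd_imp_le[of "p - 1" "j - i"] by simp
    qed
    then show "g ^ i mod p \<noteq> g ^ j mod p" by (simp add: cong_def)
  qed auto
  have "(\<lambda>i. g ^ i mod p) ` {..<p - 1} \<subseteq> {1..<p}"
    using generator_power_not_dvd p_gt_1 by (auto simp: dvd_eq_mod_eq_0 Suc_le_eq)
  moreover have "card ((\<lambda>i. g ^ i mod p) ` {..<p - 1}) = card {1..<p}"
    using card_image[OF inj] by simp
  ultimately have "(\<lambda>i. g ^ i mod p) ` {..<p - 1} = {1..<p}" by (intro card_subset_eq) auto
  with inj show ?thesis by (simp add: bij_betw_def)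
qed

text \<open>The exponents $g^i$ run through all nonzero residues, so the sum is a full geometric sum of $p$-th roots
of unity with the term $1$ removed.\<close>

lemma sum_conjugates: "(\<Sum>i<p - 1. \<sigma> i (\<zeta> ^ k)) = (if p dvd k then of_nat p else 0) - 1"
proof -
  have "(\<Sum>i<p - 1. \<sigma> i (\<zeta> ^ k)) = (\<Sum>i<p - 1. (\<zeta> ^ k) ^ (g ^ i mod p))"
  proof (rule sum.cong[OF refl])
    fix i
    have "[g ^ i * k = k * (g ^ i mod p)] (mod p)"
      by (simp add: cong_def mult.commute mod_mult_right_eq)
    then show "\<sigma> i (\<zeta> ^ k) = (\<zeta> ^ k) ^ (g ^ i mod p)"
      using zeta_power_cong by (simp add: \<sigma>_zeta_power flip: power_mult)
  qed
  also have "\<dots> = (\<Sum>j\<in>{1..<p}. (\<zeta> ^ k) ^ j)"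
    by (rule sum.reindex_bij_betw[OF generator_residues])
  also have "\<dots> = (\<Sum>j<p. (\<zeta> ^ k) ^ j) - 1"
    using p_gt_1 by (simp add: lessThan_atLeast0 sum.atLeast_Suc_lessThan)
  also have "(\<Sum>j<p. (\<zeta> ^ k) ^ j) = (if \<zeta> ^ k = 1 then of_nat p else 0)"
  proof -
    have "(\<zeta> ^ k) ^ p = 1"
      using zeta_power_eq_1_iff[of p "k * p"] p_gt_1 by (simp add: power_mult)
    then show ?thesis using geometric_sum[of "\<zeta> ^ k" p] by auto
  qed
  finally show ?thesis using zeta_power_eq_1_iff p_gt_1 by simp
qed

lemma trace_rational:
  assumes "z \<in> L"
  shows "(\<Sum>i<p - 1. \<sigma> i z) \<in> \<rat>"
proof -
  have mon: "(\<Sum>i<p - 1. \<sigma> i (\<zeta> ^ k)) \<in> \<rat>" for k unfolding sum_conjugates by simp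
  obtain f where f: "z = rat_eval f \<zeta>" by (rule in_L_E[OF assms])
  have z: "z = (\<Sum>k\<le>degree f. of_rat (coeff f k) * \<zeta> ^ k)"
    by (simp add: f poly_altdef coeff_map_poly degree_map_poly)
  have "\<sigma> i z = (\<Sum>k\<le>degree f. of_rat (coeff f k) * \<sigma> i (\<zeta> ^ k))" for i
    unfolding z by (subst \<sigma>_sum) (auto simp: \<sigma>_mult)
  then have "(\<Sum>i<p - 1. \<sigma> i z) = (\<Sum>k\<le>degree f. of_rat (coeff f k) * (\<Sum>i<p - 1. \<sigma> i (\<zeta> ^ k)))"
    by (simp add: sum_distrib_left) (rule sum.swap)
  then show ?thesis using mon by (auto intro!: Rats_sum)
qed

text \<open>The norm $N = \prod_i \sigma_i(z)$ is Galois invariant, so $(p-1)N$ is its own trace and $N$ is rational.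
The inverse of $z$ is the product of the other conjugates divided by $N$.\<close>

lemma inverse_in_L:
  assumes "z \<in> L"
  shows "inverse z \<in> L"
proof (cases "z = 0")
  case False
  define w where "w = (\<Prod>i\<in>{1..<p - 1}. \<sigma> i z)"
  have prod_L: "(\<Prod>i\<in>A. \<sigma> i z) \<in> L" for A
    by (induction A rule: infinite_finite_induct) (auto simp: assms)
  define N where "N = (\<Prod>i<p - 1. \<sigma> i z)"
  have zw: "z * w = N"
  proof -
    have "N = \<sigma> 0 z * w" using p_gt_1 unfolding N_def w_def
      by (simp add: lessThan_atLeast0 prod.atLeast_Suc_lessThan)
    then show ?thesis using \<sigma>_multiple_of_order[OF assms, of 0] by simp
  qed
  have NL: "N \<in> L" unfolding N_def by (rule prod_L)
  have \<sigma>_prod: "\<sigma> j (\<Prod>i\<in>A. \<sigma> i z) = (\<Prod>i\<in>A. \<sigma> (j + i) z)" for j A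
    by (induction A rule: infinite_finite_induct) (auto simp: \<sigma>_mult prod_L assms \<sigma>_\<sigma>)
  have fix1: "\<sigma> 1 N = N"
  proof -
    have "\<sigma> 1 N = (\<Prod>i<p - 1. \<sigma> (Suc i) z)" unfolding N_def \<sigma>_prod by simp
    also have "\<dots> = (\<Prod>i\<in>{1..<p - 1}. \<sigma> i z) * \<sigma> (p - 1) z"
    proof -
      obtain q where q: "p - 1 = Suc q" using p_gt_1 by (metis Suc_diff_Suc)
      show ?thesis unfolding q by (simp add: prod.atLeast1_atMost_eq atLeastLessThanSuc_atLeastAtMost)
    qed
    also have "\<sigma> (p - 1) z = z" using \<sigma>_multiple_of_order[OF assms] by simp
    finally show ?thesis using zw by (simp add: w_def mult.commute)
  qed
  have "\<sigma> i N = N" for i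
  proof (induction i)
    case 0
    show ?case using \<sigma>_multiple_of_order[OF NL] by simp
  next
    case (Suc i)
    then show ?case by (metis \<sigma>_\<sigma>[OF NL] fix1 plus_1_eq_Suc)
  qed
  then have "of_nat (p - 1) * N \<in> \<rat>" using trace_rational[OF NL] by simp
  then have "of_nat (p - 1) * N / of_nat (p - 1) \<in> \<rat>" by (intro Rats_divide) auto
  then have "N \<in> \<rat>" using p_gt_1 by simp
  then have "inverse N \<in> L" by (intro Rats_in_L) simp
  moreover have "N \<noteq> 0" unfolding N_def using False \<sigma>_eq_0_iff[OF assms] by simp
  then have "inverse z = w * inverse N" using zw False by (auto simp: field_simps)
  ultimately show ?thesis using prod_L by (simp add: w_def)
qed simp

lemma \<sigma>_inverse: "z \<in> L \<Longrightarrow> \<sigma> i (inverse z) = inverse (\<sigma> i z)"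
  using \<sigma>_mult[of z "inverse z" i] inverse_in_L[of z]
  by (cases "z = 0") (simp_all, metis inverse_unique)

lemma subfield_L: "subfield L complex_ring"
  by (simp add: subfield_ring_of_type_algebra_iff inverse_in_L)

lemma rat_adjoin_zeta: "rat_adjoin \<zeta> = L"
proof
  note S = subfield_generate_field[of "{\<zeta>}", unfolded subfield_ring_of_type_algebra_iff]
  have "\<zeta> \<in> L" using zeta_power_in_L[of 1] by simp
  then show "rat_adjoin \<zeta> \<subseteq> L" unfolding rat_adjoin_def by (intro generate_field_least subfield_L)
  have \<zeta>: "\<zeta> \<in> rat_adjoin \<zeta>" unfolding rat_adjoin_def by (rule generate_field.incl) simp
  have Q: "of_rat a \<in> rat_adjoin \<zeta>" for a
    using Rats_subset_subfield[OF subfield_generate_field[of "{\<zeta>}"]] unfolding rat_adjoin_def by auto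
  have "rat_eval f \<zeta> \<in> rat_adjoin \<zeta>" for f
  proof (induction f)
    case 0
    show ?case using Q[of 0] by simp
  next
    case (pCons a f)
    then show ?case using S \<zeta> Q[of a] by (simp add: rat_adjoin_def)
  qed
  then show "L \<subseteq> rat_adjoin \<zeta>" by (auto elim: in_L_E)
qed

end

section \<open>Fixed fields\<close>

lemma sum_lessThan_mult:
  fixes f :: "nat \<Rightarrow> 'a::comm_monoid_add" and k m :: nat
  shows "(\<Sum>l<k * m. f l) = (\<Sum>i<k. \<Sum>j<m. f (i + k * j))"
proof -
  have "(\<Sum>l<k * m. f l) = (\<Sum>j<m. sum f {j * k..<j * k + k})"
    by (simp add: sum.nat_group mult.commute)
  also have "\<dots> = (\<Sum>j<m. \<Sum>i<k. f (i + k * j))"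
    by (intro sum.cong[OF refl]) (simp add: sum.shift_bounds_nat_ivl lessThan_atLeast0 mult.commute
        add.commute sum.atLeastLessThan_shift_0[of f])
  finally show ?thesis by (simp add: sum.swap[of _ "{..<k}"])
qed

context prime_cyclotomic
begin

text \<open>The fixed field of the subgroup generated by the $k$-th power of the generator.  For $k$ dividing $p - 1$
that subgroup has order $(p-1)/k$.\<close>

definition Fix :: "nat \<Rightarrow> complex set" where
  "Fix k = {z \<in> L. \<sigma> k z = z}"

lemma subfield_Fix: "subfield (Fix k) complex_ring"
  by (auto simp: subfield_ring_of_type_algebra_iff Fix_def \<sigma>_add \<sigma>_mult \<sigma>_minus \<sigma>_inverse inverse_in_L)

lemma Fix_subset_L: "Fix k \<subseteq> L"
  by (auto simp: Fix_def)

lemma Fix_mono: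
  assumes "k dvd l"
  shows "Fix k \<subseteq> Fix l"
proof
  fix z assume z: "z \<in> Fix k"
  then have zL: "z \<in> L" by (simp add: Fix_def)
  have "\<sigma> (k * j) z = z" for j
  proof (induction j)
    case 0
    show ?case using \<sigma>_multiple_of_order[OF zL, of 0] by simp
  next
    case (Suc j)
    then show ?case using \<sigma>_\<sigma>[OF zL, of k "k * j"] z by (simp add: Fix_def)
  qed
  then show "z \<in> Fix l" using assms zL by (auto simp: Fix_def)
qed

text \<open>The Galois correspondence.  Let $k$ be the least positive exponent such that \<open>\<sigma> k\<close> fixes $K$ pointwise;
the exponents with this property are exactly the multiples of $k$.  To show that an element $y$ of the
fixed field lies in $K$, no degrees are compared.  Instead a function \<open>\<phi>\<close> is built with $\varphi(c) = 1$
if \<open>\<sigma> c\<close> fixes $K$ and $\varphi(c) = 0$ otherwise, such that $\sum_c \varphi(c) \sigma_c(y)$ is in $K$ for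
every $y$ in $\mathbb{Q}(\zeta_p)$.  For $y$ in the fixed field this sum is a positive integer times $y$.\<close>

lemma subfield_eq_Fix:
  assumes K: "subfield K complex_ring" and KL: "K \<subseteq> L"
  shows "\<exists>k. k dvd (p - 1) \<and> K = Fix k"
proof -
  note S = K[unfolded subfield_ring_of_type_algebra_iff]
  define stab where "stab i \<longleftrightarrow> (\<forall>y\<in>K. \<sigma> i y = y)" for i
  define k where "k = (LEAST i. i > 0 \<and> stab i)"
  have "stab (p - 1)" using KL \<sigma>_multiple_of_order by (auto simp: stab_def)
  then have k: "k > 0" "stab k"
    using LeastI[of "\<lambda>i. i > 0 \<and> stab i" "p - 1"] p_gt_1 unfolding k_def by auto
  have K_Fix: "K \<subseteq> Fix k" using k KL by (auto simp: Fix_def stab_def)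
  have stab_iff: "stab i \<longleftrightarrow> k dvd i" for i
  proof
    assume i: "stab i"
    have "stab (i mod k)" unfolding stab_def
    proof
      fix y assume y: "y \<in> K"
      then have yL: "y \<in> L" using KL by blast
      have "\<sigma> i y = \<sigma> (i mod k) (\<sigma> (k * (i div k)) y)" using yL by (simp add: \<sigma>_\<sigma>)
      moreover have "\<sigma> (k * (i div k)) y = y"
        using Fix_mono[of k "k * (i div k)"] K_Fix y by (auto simp: Fix_def)
      ultimately show "\<sigma> (i mod k) y = y" using i y by (simp add: stab_def)
    qed
    moreover have "\<not> (i mod k > 0 \<and> stab (i mod k))"
      using not_less_Least[of "i mod k" "\<lambda>i. i > 0 \<and> stab i"] k(1) by (simp add: k_def[symmetric])
    ultimately show "k dvd i" by (simp add: dvd_eq_mod_eq_0)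
  next
    assume "k dvd i"
    then show "stab i" using Fix_mono[of k i] K_Fix unfolding stab_def Fix_def by blast
  qed
  have kp: "k dvd (p - 1)" using \<open>stab (p - 1)\<close> stab_iff by simp
  \<comment> \<open>The constant function $1$ is good because traces are rational.  Multiplying by an element of
    $K$ is harmless, and a factor $\sigma_c(w)$ is absorbed into the argument $y$.\<close>
  define good where "good \<phi> \<longleftrightarrow> (\<forall>y\<in>L. (\<Sum>c<p - 1. \<phi> c * \<sigma> c y) \<in> K)" for \<phi> :: "nat \<Rightarrow> complex"
  have good_1: "good (\<lambda>c. 1)"
    unfolding good_def using trace_rational Rats_subset_subfield[OF K] by (simp add: subset_iff)
  have good_K: "good (\<lambda>c. a * \<phi> c)" if "good \<phi>" "a \<in> K" for a \<phi>
    unfolding good_def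
  proof
    fix y assume "y \<in> L"
    then have "a * (\<Sum>c<p - 1. \<phi> c * \<sigma> c y) \<in> K" using that S unfolding good_def by blast
    then show "(\<Sum>c<p - 1. a * \<phi> c * \<sigma> c y) \<in> K" by (simp add: sum_distrib_left mult.assoc)
  qed
  have good_L: "good (\<lambda>c. \<sigma> c w * \<phi> c)" if "good \<phi>" "w \<in> L" for w \<phi>
    unfolding good_def
  proof
    fix y assume y: "y \<in> L"
    then have "(\<Sum>c<p - 1. \<phi> c * \<sigma> c (w * y)) \<in> K" using that by (simp add: good_def)
    then show "(\<Sum>c<p - 1. \<sigma> c w * \<phi> c * \<sigma> c y) \<in> K" using that y by (simp add: \<sigma>_mult mult_ac)
  qed
  have good_diff: "good (\<lambda>c. \<phi> c - \<psi> c)" if "good \<phi>" "good \<psi>" for \<phi> \<psi>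
    unfolding good_def
  proof
    fix y assume "y \<in> L"
    then have "(\<Sum>c<p - 1. \<phi> c * \<sigma> c y) \<in> K" "- (\<Sum>c<p - 1. \<psi> c * \<sigma> c y) \<in> K"
      using that S unfolding good_def by blast+
    then have "(\<Sum>c<p - 1. \<phi> c * \<sigma> c y) + - (\<Sum>c<p - 1. \<psi> c * \<sigma> c y) \<in> K" using S by blast
    then show "(\<Sum>c<p - 1. (\<phi> c - \<psi> c) * \<sigma> c y) \<in> K"
      by (simp add: left_diff_distrib sum_subtractf)
  qed
  have separate: "\<exists>\<phi>. good \<phi> \<and> (\<forall>c. stab c \<longrightarrow> \<phi> c = 1) \<and> (\<forall>c\<in>C. \<phi> c = 0)"
    if "finite C" "\<forall>c\<in>C. \<not> stab c" for C
    using that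
  proof (induction C)
    case empty
    show ?case using good_1 by (intro exI[of _ "\<lambda>c. 1"]) simp
  next
    case (insert c C)
    then obtain \<phi> where \<phi>: "good \<phi>" "\<And>c. stab c \<Longrightarrow> \<phi> c = 1" "\<And>c. c \<in> C \<Longrightarrow> \<phi> c = 0"
      by (metis insertCI)
    \<comment> \<open>The extra factor $(y - \sigma_i(x))/\sigma_i(y-x)$, where $\sigma_c(x) = y$, vanishes at $i = c$.  If $\sigma_i$
      fixes $y$, then numerator and denominator agree.\<close>
    obtain y where y: "y \<in> K" "\<sigma> c y \<noteq> y" using insert.prems by (auto simp: stab_def)
    then have yL: "y \<in> L" using KL by blast
    obtain c' where c': "\<forall>z\<in>L. \<sigma> c' (\<sigma> c z) = z \<and> \<sigma> c (\<sigma> c' z) = z"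
      using \<sigma>_inverse_exists by blast
    define x where "x = \<sigma> c' y"
    have xL: "x \<in> L" and cx: "\<sigma> c x = y" using yL c' by (simp_all add: x_def)
    have "x \<noteq> y" using cx y by auto
    define w where "w = inverse (y - x)"
    have wL: "w \<in> L" unfolding w_def by (intro inverse_in_L) (simp add: xL yL)
    define \<psi> where "\<psi> = (\<lambda>i. y * (\<sigma> i w * \<phi> i) - \<sigma> i (w * x) * \<phi> i)"
    have "good \<psi>" unfolding \<psi>_def by (intro good_diff good_K good_L \<phi> y) (simp_all add: wL xL)
    moreover have "\<psi> i = 1" if "stab i" for i
    proof -
      have "\<sigma> i w * (y - \<sigma> i x) = \<sigma> i (w * (y - x))"
        using that y wL xL yL by (simp add: \<sigma>_mult \<sigma>_diff stab_def)
      also have "\<dots> = 1" using \<open>x \<noteq> y\<close> by (simp add: w_def)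
      finally show ?thesis using \<phi>(2)[OF that] wL xL by (simp add: \<psi>_def \<sigma>_mult algebra_simps)
    qed
    moreover have "\<psi> c = 0" using cx wL xL by (simp add: \<psi>_def \<sigma>_mult)
    moreover have "\<psi> i = 0" if "i \<in> C" for i using \<phi>(3)[OF that] by (simp add: \<psi>_def)
    ultimately show ?case by blast
  qed
  obtain \<phi> where \<phi>: "good \<phi>" "\<And>c. stab c \<Longrightarrow> \<phi> c = 1"
    "\<And>c. c < p - 1 \<Longrightarrow> \<not> stab c \<Longrightarrow> \<phi> c = 0"
    using separate[of "{c. c < p - 1 \<and> \<not> stab c}"] by fastforce
  have "Fix k \<subseteq> K"
  proof
    fix y assume y: "y \<in> Fix k"
    define m where "m = card {c. c < p - 1 \<and> stab c}"
    have "stab 0" by (simp add: stab_iff)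
    then have "0 \<in> {c. c < p - 1 \<and> stab c}" using p_gt_1 by simp
    then have "{c. c < p - 1 \<and> stab c} \<noteq> {}" by blast
    then have "m > 0" unfolding m_def card_gt_0_iff by simp
    have "\<phi> c * \<sigma> c y = (if stab c then y else 0)" if "c < p - 1" for c
    proof (cases "stab c")
      case True
      then have "\<sigma> c y = y" using Fix_mono[of k c] y stab_iff[of c] unfolding Fix_def by blast
      then show ?thesis using True \<phi>(2) by simp
    next
      case False
      then show ?thesis using \<phi>(3) that by simp
    qed
    then have "(\<Sum>c<p - 1. \<phi> c * \<sigma> c y) = (\<Sum>c<p - 1. if stab c then y else 0)" by simp
    also have "\<dots> = of_nat m * y"
      by (simp add: m_def sum.If_cases lessThan_def Collect_conj_eq)
    finally have "of_nat m * y \<in> K" using \<phi>(1) y by (auto simp: good_def Fix_def)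
    moreover have "inverse (of_nat m) \<in> K" using Rats_subset_subfield[OF K] by auto
    ultimately have "inverse (of_nat m) * (of_nat m * y) \<in> K" using S by blast
    then show "y \<in> K" using \<open>m > 0\<close> by (simp add: mult.assoc[symmetric])
  qed
  then show ?thesis using kp K_Fix by blast
qed

subsection \<open>Degrees of the fixed fields\<close>

text \<open>Dividing the relation by $\zeta_p$ gives a polynomial of degree below $p - 1$ that vanishes at $\zeta_p$, whose
coefficients are the \<open>a i\<close> in another order.\<close>

lemma conjugates_independent:
  assumes "(\<Sum>i<p - 1. of_rat (a i) * \<zeta> ^ (g ^ i)) = 0" "i < p - 1"
  shows "a i = 0"
proof -
  define e where "e i = g ^ i mod p - 1" for i
  define f where "f = (\<Sum>i<p - 1. monom (a i) (e i))"
  have e: "g ^ i mod p \<in> {1..<p}" if "i < p - 1" for i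
    using generator_residues that by (auto simp: bij_betw_def)
  have "\<zeta> * rat_eval f \<zeta> = (\<Sum>i<p - 1. of_rat (a i) * (\<zeta> * \<zeta> ^ e i))"
    by (simp add: f_def poly_sum poly_monom sum_distrib_left mult_ac)
  also have "\<dots> = (\<Sum>i<p - 1. of_rat (a i) * \<zeta> ^ (g ^ i))"
  proof (rule sum.cong[OF refl])
    fix i assume "i \<in> {..<p - 1}"
    then have "\<zeta> * \<zeta> ^ e i = \<zeta> ^ (g ^ i mod p)" using e[of i] by (simp add: e_def flip: power_Suc)
    also have "\<dots> = \<zeta> ^ (g ^ i)" by (rule zeta_power_cong) simp
    finally show "of_rat (a i) * (\<zeta> * \<zeta> ^ e i) = of_rat (a i) * \<zeta> ^ (g ^ i)" by simp
  qed
  finally have "rat_eval f \<zeta> = 0" using assms(1) by (auto simp: zeta_def)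
  moreover have "degree f < p - 1"
  proof -
    have "degree f \<le> p - 2"
      unfolding f_def
    proof (rule degree_sum_le)
      fix i assume "i \<in> {..<p - 1}"
      then have "1 \<le> g ^ i mod p" "g ^ i mod p < p" using e[of i] p_gt_1 by auto
      then have "e i \<le> p - 2" unfolding e_def by linarith
      then show "degree (monom (a i) (e i)) \<le> p - 2" using degree_monom_le le_trans by blast
    qed simp
    then show ?thesis using p_gt_1 by linarith
  qed
  ultimately have "f = 0" by (rule rat_poly_zeta_root_eq_0[OF prime_p])
  have "coeff f (e i) = (\<Sum>j<p - 1. if e j = e i then a j else 0)"
    by (simp add: f_def coeff_sum)
  also have "\<dots> = (\<Sum>j<p - 1. if j = i then a j else 0)"
  proof (rule sum.cong[OF refl])
    fix j assume j: "j \<in> {..<p - 1}"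
    have "e j = e i \<longleftrightarrow> g ^ j mod p = g ^ i mod p"
      using e[of i] e[of j] j assms(2) by (auto simp: e_def)
    also have "\<dots> \<longleftrightarrow> j = i"
      using inj_on_eq_iff[OF bij_betw_imp_inj_on[OF generator_residues], of j i] j assms(2) by simp
    finally show "(if e j = e i then a j else 0) = (if j = i then a j else 0)" by simp
  qed
  also have "\<dots> = a i" using assms(2) by simp
  finally show ?thesis using \<open>f = 0\<close> by simp
qed

text \<open>The Gaussian period of index $i$: the sum of the orbit of $\zeta_p^{g^i}$ under the subgroup generated by
\<open>\<sigma> k\<close>.\<close>

definition period :: "nat \<Rightarrow> nat \<Rightarrow> complex" where
  "period k i = (\<Sum>j<(p - 1) div k. \<zeta> ^ (g ^ (i + k * j)))"

lemma generator_power_cong: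
  assumes "[i = j] (mod p - 1)"
  shows "\<zeta> ^ (g ^ i) = \<zeta> ^ (g ^ j)"
  using \<sigma>_cong[of \<zeta> i j] assms \<sigma>_zeta_power[of i 1] \<sigma>_zeta_power[of j 1] zeta_power_in_L[of 1] by simp

lemma period_mod:
  assumes "k dvd p - 1"
  shows "period k i = period k (i mod k)"
proof -
  have step: "period k (i + k) = period k i" for i
  proof -
    define m where "m = (p - 1) div k"
    have km: "k * m = p - 1" using assms by (simp add: m_def)
    have "period k (i + k) + \<zeta> ^ (g ^ i) = (\<Sum>j<m. \<zeta> ^ (g ^ (i + k * Suc j))) + \<zeta> ^ (g ^ (i + k * 0))"
      by (simp add: period_def m_def algebra_simps)
    also have "\<dots> = (\<Sum>j<Suc m. \<zeta> ^ (g ^ (i + k * j)))"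
      by (simp only: sum.lessThan_Suc_shift add.commute)
    also have "\<dots> = period k i + \<zeta> ^ (g ^ (i + (p - 1)))"
      using km by (simp add: period_def m_def)
    also have "\<zeta> ^ (g ^ (i + (p - 1))) = \<zeta> ^ (g ^ i)"
      by (rule generator_power_cong) (simp add: cong_def)
    finally show ?thesis by simp
  qed
  have "period k (i mod k + k * q) = period k (i mod k)" for q
    by (induction q) (use step in \<open>simp_all add: algebra_simps, metis add.assoc add.commute\<close>)
  from this[of "i div k"] show ?thesis by simp
qed

lemma period_in_Fix:
  assumes "k dvd p - 1"
  shows "period k i \<in> Fix k"
proof -
  have L: "period k i \<in> L" unfolding period_def by (intro L_sum zeta_power_in_L)
  have "\<sigma> k (period k i) = (\<Sum>j<(p - 1) div k. \<sigma> k (\<zeta> ^ (g ^ (i + k * j))))"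
    unfolding period_def by (intro \<sigma>_sum zeta_power_in_L)
  also have "\<dots> = period k (i + k)"
    unfolding period_def by (intro sum.cong[OF refl]) (simp add: \<sigma>_zeta_power power_add mult_ac)
  also have "\<dots> = period k i" using period_mod[OF assms, of "i + k"] period_mod[OF assms, of i] by simp
  finally show ?thesis using L by (simp add: Fix_def)
qed

text \<open>An element $z$ of the fixed field is the average of its images under the subgroup.  Averaging a power of
$\zeta_p$ gives a rational multiple of a period, or a rational number, and $1$ is minus the sum of all
periods.\<close>

lemma Fix_span_periods:
  assumes k: "k dvd p - 1" and z: "z \<in> Fix k"
  shows "\<exists>a. (\<forall>i. a i \<in> \<rat>) \<and> z = (\<Sum>i<k. a i * period k i)"
proof -
  define V where "V = {z. \<exists>a. (\<forall>i. a i \<in> \<rat>) \<and> z = (\<Sum>i<k. a i * period k i)}"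
  have V0: "0 \<in> V" unfolding V_def by (auto intro!: exI[of _ "\<lambda>_. 0"])
  have V_add: "x + y \<in> V" if "x \<in> V" "y \<in> V" for x y
  proof -
    from that(1) obtain a where "(\<forall>i. a i \<in> \<rat>) \<and> x = (\<Sum>i<k. a i * period k i)"
      unfolding V_def mem_Collect_eq ..
    moreover from that(2) obtain b where "(\<forall>i. b i \<in> \<rat>) \<and> y = (\<Sum>i<k. b i * period k i)"
      unfolding V_def mem_Collect_eq ..
    ultimately
    show ?thesis unfolding V_def
      by (intro CollectI exI[of _ "\<lambda>i. a i + b i"]) (simp add: distrib_right sum.distrib)
  qed
  have V_mult: "q * x \<in> V" if "q \<in> \<rat>" "x \<in> V" for q x
  proof -
    from that(2) obtain a where "(\<forall>i. a i \<in> \<rat>) \<and> x = (\<Sum>i<k. a i * period k i)"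
      unfolding V_def mem_Collect_eq ..
    then show ?thesis unfolding V_def using that(1)
      by (intro CollectI exI[of _ "\<lambda>i. q * a i"]) (simp add: mult.assoc sum_distrib_left)
  qed
  have V_sum: "sum f A \<in> V" if "\<And>x. x \<in> A \<Longrightarrow> f x \<in> V" for f :: "nat \<Rightarrow> complex" and A
    using that by (induction A rule: infinite_finite_induct) (auto simp: V0 V_add)
  define m where "m = (p - 1) div k"
  have km: "k * m = p - 1" using k by (simp add: m_def)
  then have "k > 0" "m > 0" using p_gt_1 by (auto intro: Nat.gr0I)
  have V_period: "period k i \<in> V" for i
  proof -
    have "period k i = (\<Sum>l<k. (if l = i mod k then 1 else 0) * period k l)"
      using \<open>k > 0\<close> period_mod[OF k, of i]
      by (simp add: if_distrib[of "\<lambda>x. x * _"] cong: if_cong)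
    then show ?thesis unfolding V_def
      by (intro CollectI exI[of _ "\<lambda>l. if l = i mod k then 1 else 0"]) simp
  qed
  have V_1: "1 \<in> V"
  proof -
    have "(\<Sum>i<k. - 1 * period k i) = - (\<Sum>i<p - 1. \<zeta> ^ (g ^ i))"
      unfolding period_def m_def[symmetric] km[symmetric] sum_lessThan_mult by (simp add: sum_negf)
    also have "\<dots> = - (\<Sum>i<p - 1. \<sigma> i (\<zeta> ^ 1))" by (simp only: \<sigma>_zeta_power mult_1_right)
    also have "\<dots> = 1" unfolding sum_conjugates using p_gt_1 by simp
    finally have "1 = (\<Sum>i<k. - 1 * period k i)" ..
    also have "\<dots> \<in> V" by (intro V_sum V_mult V_period) simp
    finally show ?thesis .
  qed
  have V_orbit: "(\<Sum>j<m. \<sigma> (k * j) (\<zeta> ^ c)) \<in> V" for c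
  proof (cases "p dvd c")
    case True
    then have "\<zeta> ^ c = 1" using zeta_power_eq_1_iff p_gt_1 by simp
    then have "(\<Sum>j<m. \<sigma> (k * j) (\<zeta> ^ c)) = of_nat m * 1" by simp
    then show ?thesis using V_mult[OF Rats_of_nat V_1] by simp
  next
    case False
    then have "c mod p \<in> {1..<p}" using p_gt_1 by (auto simp: dvd_eq_mod_eq_0 Suc_le_eq)
    then obtain l where l: "g ^ l mod p = c mod p"
      using generator_residues by (metis (no_types, lifting) bij_betw_imp_surj_on imageE)
    have "\<sigma> (k * j) (\<zeta> ^ c) = \<zeta> ^ (g ^ (l + k * j))" for j
    proof -
      have "[g ^ (k * j) * c = g ^ (l + k * j)] (mod p)"
        using cong_scalar_left[of "g ^ l" c p "g ^ (k * j)"] l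
        by (simp add: cong_def power_add mult.commute)
      then show ?thesis unfolding \<sigma>_zeta_power by (rule zeta_power_cong)
    qed
    then have "(\<Sum>j<m. \<sigma> (k * j) (\<zeta> ^ c)) = period k l" by (simp add: period_def m_def)
    then show ?thesis using V_period by simp
  qed
  have zL: "z \<in> L" using z Fix_subset_L by blast
  obtain f where f: "z = rat_eval f \<zeta>" by (rule in_L_E[OF zL])
  have zsum: "z = (\<Sum>c\<le>degree f. of_rat (coeff f c) * \<zeta> ^ c)"
    by (simp add: f poly_altdef coeff_map_poly degree_map_poly)
  have "\<sigma> (k * j) z = z" for j using Fix_mono[of k "k * j"] z by (auto simp: Fix_def)
  then have "of_nat m * z = (\<Sum>j<m. \<sigma> (k * j) z)" by simp
  also have "\<dots> = (\<Sum>j<m. \<Sum>c\<le>degree f. of_rat (coeff f c) * \<sigma> (k * j) (\<zeta> ^ c))"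
    unfolding zsum by (subst \<sigma>_sum) (auto simp: \<sigma>_mult)
  also have "\<dots> = (\<Sum>c\<le>degree f. of_rat (coeff f c) * (\<Sum>j<m. \<sigma> (k * j) (\<zeta> ^ c)))"
    by (simp add: sum_distrib_left) (rule sum.swap)
  also have "\<dots> \<in> V" by (intro V_sum V_mult V_orbit) simp
  finally have "inverse (of_nat m) * (of_nat m * z) \<in> V" by (rule V_mult[rotated]) simp
  then have "z \<in> V" using \<open>m > 0\<close> by (simp add: mult.assoc[symmetric])
  then show ?thesis by (simp add: V_def)
qed

lemma periods_independent:
  assumes k: "k dvd p - 1" and a: "\<And>i. i < k \<Longrightarrow> a i \<in> \<rat>"
    and sum: "(\<Sum>i<k. a i * period k i) = 0" and i: "i < k"
  shows "a i = 0"
proof -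
  define m where "m = (p - 1) div k"
  have km: "k * m = p - 1" using k by (simp add: m_def)
  \<comment> \<open>The rational coefficients, spread out over the orbits.\<close>
  define b where "b l = (SOME r. a (l mod k) = of_rat r)" for l
  have b: "a (l mod k) = of_rat (b l)" for l
  proof -
    have "a (l mod k) \<in> \<rat>" using a i by simp
    then have "\<exists>r. a (l mod k) = of_rat r" by (auto elim: Rats_cases)
    then show ?thesis unfolding b_def by (rule someI_ex)
  qed
  have "(\<Sum>l<p - 1. of_rat (b l) * \<zeta> ^ (g ^ l)) = (\<Sum>i<k. \<Sum>j<m. a i * \<zeta> ^ (g ^ (i + k * j)))"
    unfolding km[symmetric] sum_lessThan_mult b[symmetric] by simp
  also have "\<dots> = 0" using sum by (simp add: period_def m_def sum_distrib_left)
  finally have "b i = 0"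
    by (rule conjugates_independent) (use i km dvd_imp_le[OF k] p_gt_1 in linarith)
  then show ?thesis using b[of i] i by simp
qed

text \<open>The periods with index below $k$ form a basis.\<close>

lemma dimension_Fix:
  assumes k: "k dvd p - 1"
  shows "complex_ring.dimension k \<rat> (Fix k)"
proof -
  define Us where "Us = map (period k) [0..<k]"
  have len: "length Us = k" by (simp add: Us_def)
  have comb: "complex_ring.combine Ks Us = (\<Sum>i<k. Ks ! i * period k i)" if "length Ks = k" for Ks
    using combine_complex_ring[of Ks Us] that by (simp add: Us_def)
  have "complex_ring.independent \<rat> Us"
  proof (rule complex_ring.trivial_combine_imp_independent[OF subfield_Rats])
    fix Ks assume Ks: "set Ks \<subseteq> \<rat>" "complex_ring.combine Ks Us = \<zero>\<^bsub>complex_ring\<^esub>"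
    obtain Ks' where Ks': "set (take (length Us) Ks) \<subseteq> set Ks'"
      "set Ks' \<subseteq> set (take (length Us) Ks) \<union> {0}" "length Ks' = k" "complex_ring.combine Ks' Us = 0"
      using complex_ring.combine_normalize[of Ks Us 0] Ks len by auto
    have "Ks' ! i = 0" if "i < k" for i
    proof (rule periods_independent[OF k _ _ that])
      show "Ks' ! i \<in> \<rat>" if "i < k" for i
        using nth_mem[of i Ks'] that Ks' Ks(1) set_take_subset[of k Ks] len by fastforce
      show "(\<Sum>i<k. Ks' ! i * period k i) = 0" using comb[OF Ks'(3)] Ks'(4) by simp
    qed
    then show "set (take (length Us) Ks) \<subseteq> {\<zero>\<^bsub>complex_ring\<^esub>}"
      using Ks'(1,3) by (auto simp: in_set_conv_nth dest!: subsetD)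
  qed simp
  then have "complex_ring.dimension k \<rat> (complex_ring.Span \<rat> Us)"
    using complex_ring.dimension_independent len by metis
  moreover have "complex_ring.Span \<rat> Us = Fix k"
  proof (intro equalityI subsetI)
    fix z assume "z \<in> complex_ring.Span \<rat> Us"
    then obtain Ks where Ks: "set Ks \<subseteq> \<rat>" "length Ks = k" "z = complex_ring.combine Ks Us"
      using complex_ring.Span_mem_iff_length_version[OF subfield_Rats, of Us z] len by auto
    have "Ks ! i * period k i \<in> Fix k" if "i < k" for i
    proof -
      have "Ks ! i \<in> Fix k"
        using Rats_subset_subfield[OF subfield_Fix] Ks nth_mem[of i Ks] that by blast
      then show ?thesis using period_in_Fix[OF k] subfield_Fix[of k]
        by (simp add: subfield_ring_of_type_algebra_iff)
    qed
    then have "(\<Sum>i<k. Ks ! i * period k i) \<in> Fix k" by (intro subfield_sum[OF subfield_Fix]) simp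
    then show "z \<in> Fix k" using comb[OF Ks(2)] Ks(3) by simp
  next
    fix z assume "z \<in> Fix k"
    from Fix_span_periods[OF k this]
    obtain a where "(\<forall>i. a i \<in> \<rat>) \<and> z = (\<Sum>i<k. a i * period k i)" ..
    then have a: "\<And>i. a i \<in> \<rat>" "z = (\<Sum>i<k. a i * period k i)" by simp_all
    have "z = complex_ring.combine (map a [0..<k]) Us" using a(2) comb by simp
    then show "z \<in> complex_ring.Span \<rat> Us"
      using complex_ring.Span_mem_iff_length_version[OF subfield_Rats, of Us z] a(1) len
      by (auto intro!: exI[of _ "map a [0..<k]"])
  qed
  ultimately show ?thesis by simp
qed

text \<open>Every subfield of $\mathbb{Q}(\zeta_p)$ is some \<open>Fix k\<close> and has degree $k$, so its degree determines it.\<close>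

lemma cyclotomic_subfield_eq_Fix:
  assumes m: "m dvd p - 1"
  shows "cyclotomic_subfield p m = Fix ((p - 1) div m)"
  unfolding cyclotomic_subfield_def rat_adjoin_zeta
proof (rule the_equality)
  have d: "(p - 1) div m dvd p - 1" using m by (metis dvd_mult_div_cancel dvd_triv_right)
  show "subfield (Fix ((p - 1) div m)) complex_ring \<and> Fix ((p - 1) div m) \<subseteq> L \<and>
      complex_ring.dimension ((p - 1) div m) \<rat> (Fix ((p - 1) div m))"
    using subfield_Fix Fix_subset_L dimension_Fix[OF d] by blast
  fix K assume K: "subfield K complex_ring \<and> K \<subseteq> L \<and> complex_ring.dimension ((p - 1) div m) \<rat> K"
  then obtain k where k: "k dvd p - 1" "K = Fix k" using subfield_eq_Fix by blast
  then have "k = (p - 1) div m"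
    using complex_ring.dimension_is_inj[OF subfield_Rats dimension_Fix[OF k(1)]] K by blast
  then show "K = Fix ((p - 1) div m)" using k by simp
qed

lemma rat_adjoin_eq_Fix:
  assumes "z \<in> L"
  obtains k where "k dvd p - 1" "rat_adjoin z = Fix k" "z \<in> Fix k"
proof -
  have "rat_adjoin z \<subseteq> L" unfolding rat_adjoin_def by (rule generate_field_least[OF subfield_L assms])
  then obtain k where k: "k dvd p - 1" "rat_adjoin z = Fix k"
    using subfield_eq_Fix[of "rat_adjoin z"] subfield_generate_field unfolding rat_adjoin_def by blast
  moreover have "z \<in> rat_adjoin z" unfolding rat_adjoin_def by (rule generate_field.incl) simp
  ultimately show thesis using that by blast
qed

end

section \<open>Finite fields\<close>

lemma power_minus_1_dvd:
  fixes q :: nat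
  assumes "q > 0" "t dvd r"
  shows "q ^ t - 1 dvd q ^ r - 1"
proof -
  obtain l where l: "r = t * l" using assms(2) by blast
  have "[q ^ t = 1] (mod q ^ t - 1)" using assms(1) by (simp add: cong_altdef_nat)
  then have "[(q ^ t) ^ l = 1 ^ l] (mod q ^ t - 1)" by (rule cong_pow)
  then show ?thesis using assms(1) by (simp add: l power_mult cong_altdef_nat)
qed

text \<open>Multiplication by a nonzero $x$ in $K$ permutes the nonzero elements of $K$; comparing the products of all
of them gives $x^{|K|-1} = 1$.\<close>

lemma subfield_power_card:
  assumes K: "subfield K (ring_of_type_algebra :: 'a::{field,finite} ring)" and x: "x \<in> K"
  shows "x ^ card K = x"
proof (cases "x = 0")
  case True
  then show ?thesis using x by (auto simp: zero_power card_gt_0_iff)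
next
  case False
  note S = K[unfolded subfield_ring_of_type_algebra_iff]
  have "(\<Prod>y\<in>K - {0}. y) = (\<Prod>y\<in>K - {0}. x * y)"
    by (rule prod.reindex_bij_witness[of _ "\<lambda>y. x * y" "\<lambda>y. inverse x * y"])
      (use S x False in auto)
  also have "\<dots> = x ^ card (K - {0}) * (\<Prod>y\<in>K - {0}. y)" by (simp add: prod.distrib)
  finally have "x ^ card (K - {0}) = 1" by simp
  moreover have "card K = Suc (card (K - {0}))"
    using S by (intro card.remove) (metis finite add.right_inverse)+
  ultimately show ?thesis by simp
qed

locale primitive_finite_field =
  fixes p r :: nat and \<gamma> :: "'a::{field,finite}"
  assumes prime_p: "prime p" and r_pos: "r > 0" and card_field: "CARD('a) = p ^ r"
    and primitive: "primitive_element \<gamma>"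
begin

abbreviation N :: nat where "N \<equiv> p ^ r - 1"

lemma p_ge_2: "p \<ge> 2"
  using prime_p by (rule prime_ge_2_nat)

lemma N_pos: "N > 0"
proof -
  have "p ^ r > 1" using p_ge_2 r_pos by (intro one_less_power) auto
  then show ?thesis by simp
qed

lemma power_card: "(x :: 'a) ^ (p ^ r) = x"
  using subfield_power_card[of UNIV x] card_field by (simp add: subfield_ring_of_type_algebra_iff)

lemma char_eq: "CHAR('a) = p"
proof -
  have "CHAR('a) dvd p ^ r" using CHAR_dvd_CARD[where ?'a = 'a] card_field by simp
  moreover have "prime CHAR('a)" by (intro prime_CHAR_semidom finite_imp_CHAR_pos) simp
  ultimately show ?thesis using prime_p by (metis prime_dvd_power primes_dvd_imp_eq)
qed

lemma frobenius_add: "((x :: 'a) + y) ^ (p ^ k) = x ^ (p ^ k) + y ^ (p ^ k)"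
  using freshmans_dream'[of "p ^ k" k x y] char_eq prime_p by simp

lemma frobenius_sum: "(sum f A :: 'a) ^ (p ^ k) = (\<Sum>i\<in>A. f i ^ (p ^ k))"
  using freshmans_dream_sum'[of "p ^ k" k f A] char_eq prime_p by simp

lemma frobenius_of_nat: "(of_nat m :: 'a) ^ (p ^ k) = of_nat m"
  by (induction m) (use p_ge_2 in \<open>simp_all add: frobenius_add zero_power\<close>)

lemma \<gamma>_nonzero [simp]: "\<gamma> \<noteq> 0"
proof -
  have "\<gamma> ^ 1 \<in> range (\<lambda>k. \<gamma> ^ k)" by blast
  then show ?thesis using primitive by (auto simp: primitive_element_def)
qed

lemma nonzero_power_\<gamma>:
  assumes "x \<noteq> 0"
  obtains j where "x = \<gamma> ^ j"
  using assms primitive by (auto simp: primitive_element_def)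

lemma power_N:
  assumes "(x :: 'a) \<noteq> 0"
  shows "x ^ N = 1"
proof -
  have "Suc N = p ^ r" using N_pos by simp
  then have "x * x ^ N = x" using power_card[of x] power_Suc[of x N] by argo
  then show ?thesis using assms by simp
qed

lemma power_\<gamma>_mod: "\<gamma> ^ i = \<gamma> ^ (i mod N)"
proof -
  have "\<gamma> ^ (N * (i div N) + i mod N) = \<gamma> ^ (i mod N)"
    using power_N[OF \<gamma>_nonzero] by (simp only: power_add power_mult) simp
  then show ?thesis by simp
qed

lemma power_\<gamma>_eq_iff: "\<gamma> ^ i = \<gamma> ^ j \<longleftrightarrow> [i = j] (mod N)"
proof -
  have "(\<lambda>i. \<gamma> ^ i) ` {..<N} = UNIV - {0}"
  proof -
    have "range (\<lambda>i. \<gamma> ^ i) \<subseteq> (\<lambda>i. \<gamma> ^ i) ` {..<N}"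
    proof (rule image_subsetI)
      fix i show "\<gamma> ^ i \<in> (\<lambda>i. \<gamma> ^ i) ` {..<N}"
        using power_\<gamma>_mod[of i] N_pos by (intro image_eqI[of _ _ "i mod N"]) auto
    qed
    then show ?thesis using primitive by (auto simp: primitive_element_def)
  qed
  then have "card ((\<lambda>i. \<gamma> ^ i) ` {..<N}) = card {..<N}"
    using card_field by (simp add: card_Diff_singleton)
  then have "inj_on (\<lambda>i. \<gamma> ^ i) {..<N}" by (intro eq_card_imp_inj_on) auto
  then have "\<gamma> ^ (i mod N) = \<gamma> ^ (j mod N) \<longleftrightarrow> i mod N = j mod N"
    using N_pos by (intro inj_on_eq_iff) auto
  then show ?thesis using power_\<gamma>_mod[of i] power_\<gamma>_mod[of j] by (simp add: cong_def)
qed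

lemma power_\<gamma>_eq_1_iff: "\<gamma> ^ i = 1 \<longleftrightarrow> N dvd i"
  using power_\<gamma>_eq_iff[of i 0] by (simp add: cong_0_iff)

text \<open>With $M = p^t - 1$ and $N = Mk$, the nonzero solutions are the $M$-th roots of unity, which are the powers
of $\gamma^k$.\<close>

lemma card_frobenius_fixed:
  assumes t: "t dvd r"
  shows "card {x :: 'a. x ^ (p ^ t) = x} = p ^ t"
proof -
  have "t > 0" using t r_pos by (auto intro: Nat.gr0I)
  define M where "M = p ^ t - 1"
  have "p ^ t > 1" using p_ge_2 \<open>t > 0\<close> by (intro one_less_power) auto
  then have M: "M > 0" "p ^ t = Suc M" by (simp_all add: M_def)
  have MN: "M dvd N" unfolding M_def using p_ge_2 t by (intro power_minus_1_dvd) auto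
  define k where "k = N div M"
  have k: "N = k * M" using MN by (simp add: k_def)
  have "k > 0" using N_pos k by (auto intro: Nat.gr0I)
  have "{x :: 'a. x ^ (p ^ t) = x} = insert 0 ((\<lambda>i. \<gamma> ^ (i * k)) ` {..<M})" (is "?A = insert 0 ?B")
  proof (intro equalityI subsetI)
    fix x assume x: "x \<in> ?A"
    show "x \<in> insert 0 ?B"
    proof (cases "x = 0")
      case False
      then obtain j where j: "x = \<gamma> ^ j" by (rule nonzero_power_\<gamma>)
      have "x ^ M = 1" using x M False by simp
      then have "k * M dvd j * M" using j k by (simp add: power_\<gamma>_eq_1_iff flip: power_mult)
      then have "k dvd j" using M by simp
      then obtain i where i: "j = i * k" by (metis dvd_def mult.commute)
      have "[k * i = k * (i mod M)] (mod k * M)" by (simp only: cong_def mult_mod_right mod_mod_trivial)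
      then have "[i * k = i mod M * k] (mod N)" unfolding k by (simp only: mult.commute)
      then have "x = \<gamma> ^ (i mod M * k)" using j i by (simp add: power_\<gamma>_eq_iff)
      then show ?thesis using M by auto
    qed simp
  next
    fix x assume "x \<in> insert 0 ?B"
    then show "x \<in> ?A"
    proof
      assume "x \<in> ?B"
      then obtain i where "x = \<gamma> ^ (i * k)" by blast
      then have "x ^ M = 1" using k by (simp add: power_\<gamma>_eq_1_iff flip: power_mult)
      then show ?thesis using M by simp
    qed (use M in simp)
  qed
  moreover have "inj_on (\<lambda>i. \<gamma> ^ (i * k)) {..<M}"
  proof (rule inj_onI)
    fix i j assume ij: "i \<in> {..<M}" "j \<in> {..<M}" "\<gamma> ^ (i * k) = \<gamma> ^ (j * k)"
    have "i * k < N" "j * k < N" using ij \<open>k > 0\<close> unfolding k by simp_all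
    moreover have "[i * k = j * k] (mod N)" using ij(3) by (simp only: power_\<gamma>_eq_iff)
    ultimately have "i * k = j * k" using cong_less_modulus_unique_nat by blast
    then show "i = j" using \<open>k > 0\<close> by simp
  qed
  then have "card ?B = M" by (simp add: card_image)
  moreover have "0 \<notin> ?B" by auto
  ultimately show ?thesis using M by simp
qed

text \<open>Any subfield with $p^t$ elements consists of solutions of $x^{p^t} = x$, and there are only $p^t$ of
these.\<close>

lemma finite_subfield_eq:
  assumes t: "t dvd r"
  shows "finite_subfield p t = {x :: 'a. x ^ (p ^ t) = x}"
  unfolding finite_subfield_def
proof (rule the_equality)
  let ?A = "{x :: 'a. x ^ (p ^ t) = x}"
  have minus: "(- x) ^ (p ^ t) = - x" if "x \<in> ?A" for x :: 'a
  proof -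
    have "(- x + x) ^ (p ^ t) = (- x) ^ (p ^ t) + x" using that frobenius_add[of "- x" x t] by simp
    moreover have "(- x + x) ^ (p ^ t) = 0" using p_ge_2 by (simp add: zero_power)
    ultimately show ?thesis by (metis eq_neg_iff_add_eq_0)
  qed
  then have "subfield ?A ring_of_type_algebra"
    by (simp add: subfield_ring_of_type_algebra_iff frobenius_add power_mult_distrib power_inverse)
  then show "subfield ?A ring_of_type_algebra \<and> card ?A = p ^ t" using card_frobenius_fixed[OF t] by simp
  fix K :: "'a set" assume K: "subfield K ring_of_type_algebra \<and> card K = p ^ t"
  then have "K \<subseteq> ?A" using subfield_power_card[of K] by auto
  then show "K = ?A" using K card_frobenius_fixed[OF t] by (intro card_subset_eq) auto
qed

lemma frobenius_fixed_of_nat: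
  assumes "(x :: 'a) ^ p = x"
  obtains k where "k < p" "x = of_nat k"
proof -
  have inj: "inj_on (of_nat :: nat \<Rightarrow> 'a) {..<p}"
  proof (rule inj_onI)
    fix i j assume "i \<in> {..<p}" "j \<in> {..<p}" "(of_nat i :: 'a) = of_nat j"
    then show "i = j"
      using cong_less_modulus_unique_nat[of i j p] of_nat_eq_iff_cong_CHAR[where ?'a = 'a, of i j] char_eq
      by simp
  qed
  have "of_nat ` {..<p} \<subseteq> {x :: 'a. x ^ p = x}" using frobenius_of_nat[of _ 1] by auto
  moreover have "card (of_nat ` {..<p} :: 'a set) = card {x :: 'a. x ^ p = x}"
    using card_image[OF inj] card_frobenius_fixed[of 1] by simp
  ultimately have "of_nat ` {..<p} = {x :: 'a. x ^ p = x}" by (intro card_subset_eq) auto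
  then show thesis using assms that by blast
qed

lemma abs_trace_frobenius: "abs_trace p r ((x :: 'a) ^ p) = abs_trace p r x"
  and abs_trace_power: "(abs_trace p r (x :: 'a)) ^ p = abs_trace p r x"
proof -
  have "(\<Sum>i<r. x ^ (p ^ Suc i)) + x ^ (p ^ 0) = (\<Sum>i<Suc r. x ^ (p ^ i))"
    by (simp only: sum.lessThan_Suc_shift add.commute)
  also have "\<dots> = (\<Sum>i<r. x ^ (p ^ i)) + x" using power_card[of x] by simp
  finally have e: "(\<Sum>i<r. x ^ (p ^ Suc i)) = (\<Sum>i<r. x ^ (p ^ i))" by simp
  then show "abs_trace p r (x ^ p) = abs_trace p r x"
    by (simp add: abs_trace_def flip: power_mult)
  show "(abs_trace p r x) ^ p = abs_trace p r x"
    using frobenius_sum[of "\<lambda>i. x ^ (p ^ i)" "{..<r}" 1] e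
    by (simp add: abs_trace_def mult.commute flip: power_mult)
qed

lemma abs_trace_scale: "abs_trace p r (of_nat c * (x :: 'a)) = of_nat c * abs_trace p r x"
  by (simp add: abs_trace_def power_mult_distrib frobenius_of_nat sum_distrib_left)

lemma psi_frobenius: "psi p r ((x :: 'a) ^ p) = psi p r x"
  by (simp add: psi_def abs_trace_frobenius)

end

section \<open>Conjugates of Kloosterman sums\<close>

text \<open>Substitution in all summation variables at once, by a bijection that fixes $0$.\<close>

lemma sum_PiE_reindex:
  fixes f f' :: "'a::zero \<Rightarrow> 'a" and G :: "('b \<Rightarrow> 'a) \<Rightarrow> 'c::comm_monoid_add"
  assumes "\<And>y. f' (f y) = y" "\<And>y. f (f' y) = y" "f 0 = 0"
  shows "(\<Sum>x\<in>I \<rightarrow>\<^sub>E (UNIV - {0}). G (restrict (\<lambda>i. f (x i)) I)) = (\<Sum>x\<in>I \<rightarrow>\<^sub>E (UNIV - {0}). G x)"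
proof (rule sum.reindex_bij_witness[of _ "\<lambda>x. restrict (\<lambda>i. f' (x i)) I" "\<lambda>x. restrict (\<lambda>i. f (x i)) I"])
  have nz: "f y \<noteq> 0" "f' y \<noteq> 0" if "y \<noteq> 0" for y using assms that by metis+
  fix x :: "'b \<Rightarrow> 'a" assume x: "x \<in> I \<rightarrow>\<^sub>E (UNIV - {0})"
  show "restrict (\<lambda>i. f' (restrict (\<lambda>i. f (x i)) I i)) I = x"
    "restrict (\<lambda>i. f (restrict (\<lambda>i. f' (x i)) I i)) I = x"
    using x assms by (auto simp: fun_eq_iff restrict_def PiE_def extensional_def)
  show "restrict (\<lambda>i. f (x i)) I \<in> I \<rightarrow>\<^sub>E (UNIV - {0})"
    "restrict (\<lambda>i. f' (x i)) I \<in> I \<rightarrow>\<^sub>E (UNIV - {0})"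
    using x nz by (auto simp: PiE_def Pi_def)
qed simp

lemma sum_restrict_self: "(\<Sum>i\<in>A. restrict f A i) = sum f A"
  and prod_restrict_self: "(\<Prod>i\<in>A. restrict f A i) = prod f A"
  by (auto intro: sum.cong prod.cong)

context primitive_finite_field
begin

text \<open>Substituting $x_i^p$ for $x_i$ raises the argument of $\psi$ to its $p$-th power, which does not change its
trace.\<close>

lemma kloosterman_frobenius: "kloosterman p r n ((a :: 'a) ^ p) = kloosterman p r n a"
proof -
  obtain s where s: "r = Suc s" using r_pos by (metis Suc_pred)
  have inv: "((y :: 'a) ^ p) ^ (p ^ s) = y" "(y ^ (p ^ s)) ^ p = y" for y
    using power_card[of y] by (simp_all add: s mult.commute flip: power_mult)
  define G where "G x = psi p r ((\<Sum>i=1..n. x i) + a ^ p / (\<Prod>i=1..n. x i))" for x :: "nat \<Rightarrow> 'a"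
  have "kloosterman p r n (a ^ p) = (\<Sum>x\<in>{1..n} \<rightarrow>\<^sub>E (UNIV - {0}). G x)"
    by (simp add: kloosterman_def G_def)
  also have "\<dots> = (\<Sum>x\<in>{1..n} \<rightarrow>\<^sub>E (UNIV - {0}). G (restrict (\<lambda>i. x i ^ p) {1..n}))"
    by (rule sum_PiE_reindex[symmetric, of "\<lambda>y. y ^ (p ^ s)"])
      (use inv p_ge_2 in \<open>auto simp: zero_power\<close>)
  also have "\<dots> = kloosterman p r n a"
    unfolding kloosterman_def
  proof (rule sum.cong[OF refl])
    fix x :: "nat \<Rightarrow> 'a"
    have "G (restrict (\<lambda>i. x i ^ p) {1..n}) = psi p r (((\<Sum>i=1..n. x i) + a / (\<Prod>i=1..n. x i)) ^ p)"
      unfolding G_def sum_restrict_self prod_restrict_self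
      using frobenius_add[of _ _ 1] frobenius_sum[of x "{1..n}" 1]
      by (simp add: prod_power_distrib power_divide)
    then show "G (restrict (\<lambda>i. x i ^ p) {1..n}) = psi p r ((\<Sum>i=1..n. x i) + a / (\<Prod>i=1..n. x i))"
      by (simp add: psi_frobenius)
  qed
  finally show ?thesis .
qed

lemma kloosterman_frobenius_power: "kloosterman p r n ((a :: 'a) ^ (p ^ s)) = kloosterman p r n a"
proof (induction s)
  case (Suc s)
  then show ?case using kloosterman_frobenius[of n "a ^ (p ^ s)"]
    by (simp add: mult.commute flip: power_mult)
qed simp

end

locale kloosterman_field = primitive_finite_field p r \<gamma> + prime_cyclotomic p g
  for p r g :: nat and \<gamma> :: "'a::{field,finite}"
begin

lemma psi_eq:
  assumes "of_nat k = abs_trace p r (x :: 'a)"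
  shows "psi p r x = \<zeta> ^ k"
proof -
  have "(THE k. k < p \<and> of_nat k = abs_trace p r x) = k mod p"
  proof (rule the_equality)
    show "k mod p < p \<and> of_nat (k mod p) = abs_trace p r x"
      using p_gt_1 by (simp add: assms[symmetric] of_nat_eq_iff_cong_CHAR char_eq)
    show "l = k mod p" if "l < p \<and> of_nat l = abs_trace p r x" for l
      using that unfolding assms[symmetric] of_nat_eq_iff_cong_CHAR char_eq
      by (metis cong_def mod_less)
  qed
  then show ?thesis unfolding psi_def by (simp add: zeta_power_cong[of "k mod p" k])
qed

lemma psi_in_L [simp]: "psi p r (x :: 'a) \<in> L"
  by (simp add: psi_def)

lemma \<sigma>_psi: "\<sigma> i (psi p r x) = psi p r (of_nat (g ^ i) * (x :: 'a))"
proof -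
  obtain k where k: "abs_trace p r x = of_nat k"
    by (rule frobenius_fixed_of_nat[OF abs_trace_power])
  have "of_nat (g ^ i * k) = abs_trace p r (of_nat (g ^ i) * x)"
    unfolding abs_trace_scale k by simp
  then show ?thesis using psi_eq[of k x] k psi_eq[of "g ^ i * k"] by (simp add: \<sigma>_zeta_power)
qed

lemma kloosterman_in_L [simp]: "kloosterman p r n (a :: 'a) \<in> L"
  unfolding kloosterman_def by (intro L_sum psi_in_L)

lemma of_nat_generator_power_eq_1_iff: "(of_nat g :: 'a) ^ i = 1 \<longleftrightarrow> p - 1 dvd i"
  using of_nat_eq_iff_cong_CHAR[where ?'a = 'a, of "g ^ i" 1] generator[of i] char_eq by simp

lemma of_nat_generator_nonzero: "(of_nat g :: 'a) \<noteq> 0"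
  using generator_power_not_dvd[of 1] of_nat_eq_0_iff_char_dvd[where ?'a = 'a, of g] char_eq by simp

text \<open>With $c = g^i$, the automorphism replaces $\psi(x)$ by $\psi(cx)$, and the substitution $x_i \mapsto c x_i$
moves the factor: $c \cdot a/\prod x_i = c^{n+1} a/\prod (c x_i)$.\<close>

lemma \<sigma>_kloosterman:
  "\<sigma> i (kloosterman p r n a) = kloosterman p r n ((of_nat g ^ (n + 1)) ^ i * (a :: 'a))"
proof -
  define c :: 'a where "c = of_nat (g ^ i)"
  have c: "c \<noteq> 0" using of_nat_generator_nonzero by (simp add: c_def)
  define G where "G x = psi p r ((\<Sum>i=1..n. x i) + c ^ (n + 1) * a / (\<Prod>i=1..n. x i))" for x :: "nat \<Rightarrow> 'a"
  have "\<sigma> i (kloosterman p r n a) =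
      (\<Sum>x\<in>{1..n} \<rightarrow>\<^sub>E (UNIV - {0}). psi p r (c * ((\<Sum>i=1..n. x i) + a / (\<Prod>i=1..n. x i))))"
    unfolding kloosterman_def by (subst \<sigma>_sum) (simp_all add: \<sigma>_psi c_def)
  also have "\<dots> = (\<Sum>x\<in>{1..n} \<rightarrow>\<^sub>E (UNIV - {0}). G (restrict (\<lambda>i. c * x i) {1..n}))"
  proof (rule sum.cong[OF refl])
    fix x :: "nat \<Rightarrow> 'a"
    have "G (restrict (\<lambda>i. c * x i) {1..n}) = psi p r ((\<Sum>i=1..n. c * x i) + c ^ (n + 1) * a / (\<Prod>i=1..n. c * x i))"
      unfolding G_def sum_restrict_self prod_restrict_self ..
    also have "(\<Prod>i=1..n. c * x i) = c ^ n * (\<Prod>i=1..n. x i)" by (simp add: prod.distrib)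
    also have "c ^ (n + 1) * a / (c ^ n * (\<Prod>i=1..n. x i)) = c * (a / (\<Prod>i=1..n. x i))"
      using c by (simp add: field_simps)
    finally show "psi p r (c * ((\<Sum>i=1..n. x i) + a / (\<Prod>i=1..n. x i))) = G (restrict (\<lambda>i. c * x i) {1..n})"
      by (simp only: distrib_left sum_distrib_left)
  qed
  also have "\<dots> = (\<Sum>x\<in>{1..n} \<rightarrow>\<^sub>E (UNIV - {0}). G x)"
    by (rule sum_PiE_reindex[of "\<lambda>y. y / c"]) (use c in auto)
  also have "\<dots> = kloosterman p r n ((of_nat g ^ (n + 1)) ^ i * a)"
  proof -
    have "c ^ (n + 1) = (of_nat g ^ (n + 1)) ^ i"
      by (simp only: c_def of_nat_power power_mult[symmetric] mult.commute)
    then show ?thesis unfolding kloosterman_def G_def by simp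
  qed
  finally show ?thesis .
qed

end

section \<open>Elements with a prescribed Frobenius quotient\<close>

text \<open>With $y = q^t \equiv 1$ modulo $e$, the quotient $(y^e-1)/(y-1) = 1 + y + \dots + y^{e-1}$ is congruent to
$e \equiv 0$ modulo $e$.  This makes the exponent of the $e$-th root of $\gamma_t$ an integer.\<close>

lemma mult_power_minus_1_dvd:
  fixes q :: nat
  assumes "q > 0" "e dvd q - 1" "t * e dvd r"
  shows "e * (q ^ t - 1) dvd q ^ r - 1"
proof -
  define y where "y = int q ^ t"
  have y: "int e dvd y - 1"
  proof -
    have "q ^ 1 - 1 dvd q ^ t - 1" using assms(1) by (intro power_minus_1_dvd) auto
    then have "e dvd q ^ t - 1" using assms(2) dvd_trans by fastforce
    then have "int e dvd int (q ^ t - 1)" by simp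
    then show ?thesis using assms(1) by (simp add: y_def of_nat_diff)
  qed
  have "[(\<Sum>i<e. y ^ i) = (\<Sum>i<e. 1 ^ i)] (mod int e)"
    using y by (intro cong_sum cong_pow) (simp add: cong_iff_dvd_diff)
  from cong_dvd_iff[OF this] have "int e dvd (\<Sum>i<e. y ^ i)" by simp
  then have "(y - 1) * int e dvd y ^ e - 1"
    unfolding power_diff_1_eq[of y e] by (intro mult_dvd_mono) auto
  then have "int ((q ^ t - 1) * e) dvd int (q ^ (t * e) - 1)"
    using assms(1) by (simp add: y_def of_nat_diff power_mult)
  then have "(q ^ t - 1) * e dvd q ^ (t * e) - 1" by (simp only: of_nat_dvd_iff)
  also have "\<dots> dvd q ^ r - 1" using assms by (intro power_minus_1_dvd) auto
  finally show ?thesis by (simp add: mult.commute)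
qed

context primitive_finite_field
begin

lemma frobenius_fixed_power:
  assumes "(x :: 'a) ^ (p ^ t) = x"
  shows "x ^ (p ^ (t * l)) = x"
proof (induction l)
  case (Suc l)
  have "x ^ (p ^ (t * Suc l)) = (x ^ (p ^ (t * l))) ^ (p ^ t)"
    by (simp add: power_add mult.commute flip: power_mult)
  then show ?case using Suc assms by simp
qed simp

text \<open>Since $v$ lies in the prime field, the map $s \mapsto a^{p^s}/a$ behaves like a homomorphism on the
multiples of $t$.\<close>

lemma frobenius_quotient_power:
  assumes a: "(a :: 'a) ^ (p ^ t) = v * a" and v: "v ^ p = v"
  shows "a ^ (p ^ (t * l)) = v ^ l * a"
proof (induction l)
  case (Suc l)
  have "(v ^ l) ^ p = (v ^ p) ^ l" by (simp add: mult.commute flip: power_mult)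
  then have "(v ^ l) ^ (p ^ t) = v ^ l" using frobenius_fixed_power[of "v ^ l" 1 t] v by simp
  moreover have "a ^ (p ^ (t * Suc l)) = (a ^ (p ^ (t * l))) ^ (p ^ t)"
    by (simp add: power_add mult.commute flip: power_mult)
  ultimately show ?case using Suc a by (simp add: power_mult_distrib mult_ac)
qed simp

lemma root_of_unity_frobenius_fixed:
  assumes "(v :: 'a) ^ e = 1" "e dvd p - 1"
  shows "v ^ p = v"
proof -
  obtain l where l: "p - 1 = e * l" using assms(2) by blast
  have "v ^ (p - 1) = 1" unfolding l power_mult assms(1) by simp
  moreover have "p = Suc (p - 1)" using p_ge_2 by simp
  ultimately show ?thesis by (metis power_Suc mult_1_right)
qed

text \<open>Here $\omega$ is an element of order $e$ in the prime field.  For the implication from left to right let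
$t$ be the degree of $x = a^e$ over the prime field.  Then $v = a^{p^t-1}$ is an $e$-th root of unity, and
$\omega$ is a power of $v$ because the exponent $s$ is a multiple of $t$; so $v$ has order $e$.  As
$a^{p^r} = a$, the order $e$ divides $r/t$.  Writing $a$ as a power of $\gamma$, the equation $v^e = 1$ says
that $a$ is a power $\gamma^{Bu'}$ of the $e$-th root $\gamma^B$ of $\gamma_t$, and splitting $u'$ modulo $e$
gives the coset.  Conversely, on the coset $a^{p^t-1}$ has order $e$, so $\omega$ is one of its powers.\<close>

lemma frobenius_quotient_iff_coset:
  fixes a \<omega> :: 'a
  assumes e: "e > 1" "e dvd p - 1" "e dvd r" and a: "a \<noteq> 0"
    and \<omega>: "\<And>i. \<omega> ^ i = 1 \<longleftrightarrow> e dvd i"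
  shows "(\<exists>s. \<omega> * a = a ^ (p ^ s)) \<longleftrightarrow>
    (\<exists>t u. t dvd r div e \<and> u \<in> {1..e - 1} \<and> gcd e u = 1 \<and>
       a \<in> (\<lambda>c. (\<gamma> ^ ((p ^ r - 1) div (e * (p ^ t - 1)))) ^ u * c) ` (finite_subfield p t - {0}))"
    (is "?L \<longleftrightarrow> ?R")
proof
  assume ?L
  then obtain s where s: "\<omega> * a = a ^ (p ^ s)" by blast
  have "\<omega> ^ e = 1" using \<omega> by simp
  define x where "x = a ^ e"
  define t where "t = (LEAST t. t > 0 \<and> x ^ (p ^ t) = x)"
  have t: "t > 0" "x ^ (p ^ t) = x"
    using LeastI[of "\<lambda>t. t > 0 \<and> x ^ (p ^ t) = x" r] r_pos power_card unfolding t_def by auto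
  have t_dvd: "t dvd i" if "x ^ (p ^ i) = x" for i
  proof -
    have "x ^ (p ^ (t * (i div t) + i mod t)) = (x ^ (p ^ (t * (i div t)))) ^ (p ^ (i mod t))"
      by (simp only: power_add power_mult)
    then have "x ^ (p ^ (i mod t)) = x" using that frobenius_fixed_power[OF t(2)] by simp
    then have "\<not> i mod t > 0"
      using not_less_Least[of "i mod t" "\<lambda>t. t > 0 \<and> x ^ (p ^ t) = x"] t(1)
      unfolding t_def[symmetric] by simp
    then show ?thesis by (simp add: dvd_eq_mod_eq_0)
  qed
  define v where "v = a ^ (p ^ t - 1)"
  have "Suc (p ^ t - 1) = p ^ t" using p_ge_2 by simp
  then have va: "a ^ (p ^ t) = v * a" unfolding v_def by (metis power_Suc2)
  have "v ^ e * x = x"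
    using t(2) unfolding x_def power_mult_distrib[symmetric] va[symmetric]
    by (simp add: mult.commute flip: power_mult)
  then have ve: "v ^ e = 1" using a by (simp add: x_def)
  have vp: "v ^ p = v" by (rule root_of_unity_frobenius_fixed[OF ve e(2)])
  have "x ^ (p ^ s) = (a ^ (p ^ s)) ^ e" by (simp add: x_def mult.commute flip: power_mult)
  also have "\<dots> = x" using \<open>\<omega> ^ e = 1\<close> by (simp add: s[symmetric] power_mult_distrib x_def)
  finally obtain l where l: "s = t * l" using t_dvd by blast
  have v\<omega>: "v ^ l = \<omega>" using frobenius_quotient_power[OF va vp, of l] s a by (simp add: l)
  obtain l' where l': "r = t * l'" using t_dvd[OF power_card] by blast
  have "v ^ l' = 1" using frobenius_quotient_power[OF va vp, of l'] power_card[of a] a by (simp add: l')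
  have v_order: "e dvd i" if "v ^ i = 1" for i
  proof -
    have "\<omega> ^ i = (v ^ i) ^ l" by (simp add: v\<omega>[symmetric] mult.commute flip: power_mult)
    then show ?thesis using that \<omega> by simp
  qed
  then have "e dvd l'" using \<open>v ^ l' = 1\<close> by blast
  then obtain q where q: "r = t * (e * q)" using l' by blast
  have tr: "t dvd r div e" using e(1) by (simp add: q)
  define B where "B = N div (e * (p ^ t - 1))"
  have "e * (p ^ t - 1) dvd N"
    using p_ge_2 e(2) by (intro mult_power_minus_1_dvd) (auto simp: q)
  then have B: "N = e * (p ^ t - 1) * B" by (simp add: B_def)
  then have pos: "e > 0" "p ^ t - 1 > 0" "B > 0" using N_pos by (auto intro!: Nat.gr0I)
  obtain j where j: "a = \<gamma> ^ j" using nonzero_power_\<gamma>[OF a] by blast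
  have "N dvd j * (p ^ t - 1) * e"
    using ve unfolding v_def j by (simp only: power_\<gamma>_eq_1_iff flip: power_mult)
  then have "(e * (p ^ t - 1)) * B dvd (e * (p ^ t - 1)) * j" unfolding B by (simp only: mult_ac)
  then have "B dvd j" using pos by simp
  then obtain u' where u': "j = B * u'" by blast
  \<comment> \<open>The multiple of $e$ in the exponent $u'$ contributes powers of $\gamma_t$, which lie in the subfield.\<close>
  define u where "u = u' mod e"
  have "coprime e u'"
  proof -
    define h where "h = gcd e u'"
    obtain e' where e': "e = h * e'" unfolding h_def by (metis gcd_dvd1 dvdE)
    obtain u'' where u'': "u' = h * u''" unfolding h_def by (metis gcd_dvd2 dvdE)
    have "B * u' * (p ^ t - 1) * e' = N * u''" unfolding B e' u'' by (simp only: mult_ac)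
    then have "v ^ e' = 1" unfolding v_def j u'
      by (simp only: power_mult[symmetric] power_\<gamma>_eq_1_iff) simp
    then have "e dvd e'" by (rule v_order)
    then have "h = 1" using e' pos(1) by (auto dest!: dvd_imp_le)
    then show ?thesis unfolding h_def coprime_iff_gcd_eq_1 .
  qed
  then have gcd_u: "gcd e u = 1"
    unfolding u_def coprime_iff_gcd_eq_1 using gcd_red_nat[of u' e] gcd.commute[of u' e] by argo
  then have "u \<noteq> 0" using e(1) by (intro notI) simp
  moreover have "u < e" using e(1) by (simp add: u_def)
  ultimately have u: "u \<in> {1..e - 1}" by simp
  define c where "c = \<gamma> ^ (B * (e * (u' div e)))"
  have "u' = u + e * (u' div e)" by (simp add: u_def)
  then have "j = B * u + B * (e * (u' div e))" using u' distrib_left by metis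
  then have ac: "a = (\<gamma> ^ B) ^ u * c" by (simp add: j c_def power_add flip: power_mult)
  have "c ^ (p ^ t - 1) = 1"
  proof -
    have "B * (e * (u' div e)) * (p ^ t - 1) = N * (u' div e)" unfolding B by (simp only: mult_ac)
    then show ?thesis unfolding c_def by (simp only: power_mult[symmetric] power_\<gamma>_eq_1_iff) simp
  qed
  then have "c ^ (p ^ t) = c" using \<open>Suc (p ^ t - 1) = p ^ t\<close> by (metis power_Suc mult_1_right)
  moreover have "c \<noteq> 0" by (simp add: c_def)
  moreover have "t dvd r" using l' by simp
  ultimately have c: "c \<in> finite_subfield p t - {0}" by (simp add: finite_subfield_eq)
  show ?R
    by (intro exI conjI image_eqI[of _ _ c]) (fact tr, fact u, fact gcd_u, fact ac[unfolded B_def], fact c)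
next
  assume ?R
  then obtain t u where tr: "t dvd r div e" and gcd_u: "gcd e u = 1"
    and "a \<in> (\<lambda>c. (\<gamma> ^ ((p ^ r - 1) div (e * (p ^ t - 1)))) ^ u * c) ` (finite_subfield p t - {0})"
    by (elim exE conjE) (rule that)
  then obtain c where c: "c \<in> finite_subfield p t - {0}"
    and ac: "a = (\<gamma> ^ ((p ^ r - 1) div (e * (p ^ t - 1)))) ^ u * c" by (elim imageE)
  obtain q where q: "r = t * e * q"
    using tr e(3) by (metis dvd_def dvd_mult_div_cancel mult.assoc mult.commute)
  have "t dvd r" by (simp add: q mult.assoc)
  then have c: "c ^ (p ^ t) = c" "c \<noteq> 0" using c by (simp_all add: finite_subfield_eq)
  define B where "B = N div (e * (p ^ t - 1))"
  have "e * (p ^ t - 1) dvd N"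
    using p_ge_2 e(2) by (intro mult_power_minus_1_dvd) (auto simp: q)
  then have "N = e * (p ^ t - 1) * B" by (simp add: B_def)
  then have B: "N = e * ((p ^ t - 1) * B)" by (simp only: mult.assoc)
  \<comment> \<open>The element $\gamma^C$ has order $e$; both $v$ and $\omega$ are powers of it.\<close>
  define C where "C = (p ^ t - 1) * B"
  have C: "N = e * C" "C > 0" using B N_pos by (auto simp: C_def intro!: Nat.gr0I)
  define v where "v = \<gamma> ^ (C * u)"
  have "v ^ e = \<gamma> ^ (N * u)" unfolding v_def C(1) by (simp add: mult_ac flip: power_mult)
  then have vp: "v ^ p = v"
    by (intro root_of_unity_frobenius_fixed[OF _ e(2)]) (simp add: power_\<gamma>_eq_1_iff)
  have va: "a ^ (p ^ t) = v * a"
  proof -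
    have "p ^ t = Suc (p ^ t - 1)" using p_ge_2 by simp
    then have "B * u * p ^ t = C * u + B * u"
      unfolding C_def by (metis mult.assoc mult.commute mult_Suc add.commute)
    then have "((\<gamma> ^ B) ^ u) ^ (p ^ t) = v * (\<gamma> ^ B) ^ u"
      by (simp only: v_def power_add[symmetric] power_mult[symmetric])
    then show ?thesis unfolding ac B_def[symmetric] power_mult_distrib c by (simp add: mult_ac)
  qed
  have "\<omega> \<noteq> 0" using \<omega>[of e] e(1) by (auto simp: zero_power)
  then obtain z where z: "\<omega> = \<gamma> ^ z" by (rule nonzero_power_\<gamma>)
  have "\<omega> ^ e = 1" using \<omega> by simp
  then have "e * C dvd e * z" unfolding z C(1)[symmetric]
    by (simp only: power_\<gamma>_eq_1_iff mult.commute flip: power_mult)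
  then obtain z' where z': "z = C * z'" using e(1) by auto
  have "coprime u e" unfolding coprime_iff_gcd_eq_1 using gcd_u by (simp only: gcd.commute)
  then obtain l where "[u * l = Suc 0] (mod e)" using cong_solve_coprime_nat by blast
  then have "[u * l * z' = Suc 0 * z'] (mod e)" by (rule cong_scalar_right)
  then have "[C * (u * l * z') = C * z'] (mod (C * e))"
    by (simp only: cong_def mult_mod_right[symmetric] mult_Suc mult_0 add_0_right)
  then have "\<gamma> ^ (C * (u * l * z')) = \<omega>"
    unfolding z z' power_\<gamma>_eq_iff C(1) by (simp add: mult.commute)
  then have "v ^ (l * z') = \<omega>" unfolding v_def by (simp only: mult_ac flip: power_mult)
  then have "\<omega> * a = a ^ (p ^ (t * (l * z')))" using frobenius_quotient_power[OF va vp] by simp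
  then show ?L by blast
qed

end

section \<open>The fields generated by Kloosterman sums\<close>

lemma dvd_mult_iff_div_gcd_dvd:
  fixes a b i :: nat
  assumes "b > 0"
  shows "b dvd a * i \<longleftrightarrow> b div gcd a b dvd i"
proof -
  define d where "d = gcd a b"
  have d: "d > 0" using assms by (simp add: d_def)
  obtain a' where a': "a = d * a'" unfolding d_def by (metis gcd_dvd1 dvdE)
  obtain b' where b': "b = d * b'" unfolding d_def by (metis gcd_dvd2 dvdE)
  have "coprime a' b'" using div_gcd_coprime[of a b] assms d
    unfolding d_def[symmetric] by (simp add: a' b')
  then show ?thesis using d unfolding d_def[symmetric]
    by (simp add: a' b' mult.assoc coprime_dvd_mult_right_iff coprime_commute)
qed

theorem theorem2:
  fixes \<gamma> :: "'a::{field,finite}" and p r n d R :: nat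
  assumes "prime p" and "r > 0" and "n > 0"
    and "CARD('a) = p ^ r"
    and "d = gcd (n + 1) (p - 1)"
    and "R = gcd ((p - 1) div d) r"
    and "primitive_element \<gamma>"
    and distinctness:
      "\<And>a b :: 'a. a \<noteq> 0 \<Longrightarrow> b \<noteq> 0 \<Longrightarrow> kloosterman p r n a = kloosterman p r n b \<Longrightarrow>
         \<exists>s<r. b = a ^ (p ^ s)"
  shows
    "(\<forall>a::'a. a \<noteq> 0 \<longrightarrow>
        cyclotomic_subfield p (d * R) \<subseteq> rat_adjoin (kloosterman p r n a) \<and>
        rat_adjoin (kloosterman p r n a) \<subseteq> cyclotomic_subfield p d) \<and>
     (\<forall>(e::nat) (a::'a). e dvd R \<and> e > 1 \<and> a \<noteq> 0 \<longrightarrow>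
        (kloosterman p r n a \<in> cyclotomic_subfield p (d * e) \<longleftrightarrow>
         (\<exists>t u. t dvd r div e \<and> u \<in> {1..e - 1} \<and> gcd e u = 1 \<and>
            a \<in> (\<lambda>c. (\<gamma> ^ ((p ^ r - 1) div (e * (p ^ t - 1)))) ^ u * c) `
                  (finite_subfield p t - {0}))))"
proof -
  obtain g where g: "g \<in> totatives p" "ord p g = p - 1"
    using residue_prime_has_primroot[OF assms(1)] by blast
  interpret kloosterman_field p r g \<gamma>
    by standard (use assms(1,2,4,7) g(2) ord_divides[of g _ p] in simp_all)
  define M where "M = (p - 1) div d"
  have dM: "p - 1 = d * M" using assms(5) by (simp add: M_def)
  have M: "M > 0" "d > 0" using dM p_gt_1 by (auto intro!: Nat.gr0I)
  have RM: "R dvd M" and Rr: "R dvd r" using assms(6) by (simp_all add: M_def)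
  \<comment> \<open>The generator of the Galois group maps the sum at $a$ to the sum at $wa$; the order of $w$ is $M$.\<close>
  define w :: 'a where "w = of_nat g ^ (n + 1)"
  have w0: "w \<noteq> 0" using of_nat_generator_nonzero by (simp add: w_def)
  have w_order: "w ^ i = 1 \<longleftrightarrow> M dvd i" for i
  proof -
    have "w ^ i = 1 \<longleftrightarrow> p - 1 dvd (n + 1) * i"
      unfolding w_def power_mult[symmetric] by (rule of_nat_generator_power_eq_1_iff)
    then show ?thesis
      using dvd_mult_iff_div_gcd_dvd[of "p - 1" "n + 1" i] p_gt_1 assms(5) by (simp add: M_def)
  qed
  have w_p: "(w ^ k) ^ p = w ^ k" for k
    using frobenius_of_nat[of "(g ^ (n + 1)) ^ k" 1] by (simp add: w_def)
  have \<sigma>_fixes_iff: "\<sigma> k (kloosterman p r n a) = kloosterman p r n a \<longleftrightarrow>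
      (\<exists>s. w ^ k * a = a ^ (p ^ s))" if "a \<noteq> 0" for k a
  proof
    assume "\<sigma> k (kloosterman p r n a) = kloosterman p r n a"
    then have "kloosterman p r n a = kloosterman p r n (w ^ k * a)"
      by (simp only: \<sigma>_kloosterman w_def)
    then show "\<exists>s. w ^ k * a = a ^ (p ^ s)" using distinctness[of a "w ^ k * a"] that w0 by auto
  next
    assume "\<exists>s. w ^ k * a = a ^ (p ^ s)"
    then obtain s where "w ^ k * a = a ^ (p ^ s)" ..
    then show "\<sigma> k (kloosterman p r n a) = kloosterman p r n a"
      by (simp only: \<sigma>_kloosterman w_def[symmetric] kloosterman_frobenius_power)
  qed
  have E_eq: "cyclotomic_subfield p (d * e) = Fix (M div e)" if "e dvd M" for e
  proof -
    have "d * e dvd p - 1" unfolding dM using that by (rule mult_dvd_mono[OF dvd_refl])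
    then have "cyclotomic_subfield p (d * e) = Fix ((p - 1) div (d * e))"
      by (rule cyclotomic_subfield_eq_Fix)
    also have "(p - 1) div (d * e) = M div e" using M unfolding dM by simp
    finally show ?thesis .
  qed
  show ?thesis
  proof (intro conjI allI impI)
    fix a :: 'a assume a: "a \<noteq> 0"
    \<comment> \<open>Upper bound: the $M$-th power of the generator multiplies the argument by $w^M = 1$.\<close>
    have "w ^ M * a = a ^ (p ^ 0)" using w_order[of M] by simp
    then have "\<sigma> M (kloosterman p r n a) = kloosterman p r n a" using \<sigma>_fixes_iff[OF a] by blast
    then have "kloosterman p r n a \<in> Fix M" by (simp add: Fix_def)
    then have "rat_adjoin (kloosterman p r n a) \<subseteq> Fix M"
      unfolding rat_adjoin_def by (intro generate_field_least subfield_Fix)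
    then show "rat_adjoin (kloosterman p r n a) \<subseteq> cyclotomic_subfield p d" using E_eq[of 1] by simp
    obtain k where k: "rat_adjoin (kloosterman p r n a) = Fix k" "kloosterman p r n a \<in> Fix k"
      using rat_adjoin_eq_Fix[OF kloosterman_in_L] by blast
    then have "\<sigma> k (kloosterman p r n a) = kloosterman p r n a" by (simp add: Fix_def)
    then obtain s where s: "a ^ (p ^ s) = w ^ k * a"
      unfolding \<sigma>_fixes_iff[OF a] by metis
    \<comment> \<open>Lower bound: $w^k = a^{p^s-1}$ lies in the prime field, so applying $x \mapsto x^{p^s}$ to $a$ repeatedly, $r$ times in
      all, multiplies $a$ by $w^{kr}$ and also returns $a$.  Hence $w^{kr} = 1$.\<close>
    have "(w ^ k) ^ r * a = a ^ (p ^ (r * s))"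
      using frobenius_quotient_power[OF s w_p, of r] by (simp add: mult.commute)
    also have "\<dots> = a" by (rule frobenius_fixed_power[OF power_card])
    finally have "w ^ (k * r) = 1" using a by (simp add: power_mult)
    then have "M dvd k * r" by (simp add: w_order)
    then have "M dvd gcd (k * M) (k * r)" by simp
    also have "gcd (k * M) (k * r) = k * R" using assms(6) by (simp add: gcd_mult_distrib_nat M_def)
    finally have "M dvd k * R" .
    then have "M div R * R dvd k * R" using RM by simp
    moreover have "R \<noteq> 0" using RM M by auto
    ultimately have "M div R dvd k" by simp
    then show "cyclotomic_subfield p (d * R) \<subseteq> rat_adjoin (kloosterman p r n a)"
      using E_eq[OF RM] k(1) Fix_mono by simp
  next
    fix e :: nat and a :: 'a assume A: "e dvd R \<and> e > 1 \<and> a \<noteq> 0"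
    have eM: "e dvd M" using A RM by (auto intro: dvd_trans)
    have er: "e dvd r" using A Rr by (auto intro: dvd_trans)
    have ep: "e dvd p - 1" unfolding dM using eM by simp
    define \<omega> where "\<omega> = w ^ (M div e)"
    have \<omega>: "\<omega> ^ i = 1 \<longleftrightarrow> e dvd i" for i
    proof -
      obtain m where m: "M = e * m" using eM by blast
      have "\<omega> ^ i = 1 \<longleftrightarrow> M dvd M div e * i" unfolding \<omega>_def power_mult[symmetric] by (rule w_order)
      then show ?thesis using A M unfolding m by (simp add: mult.commute)
    qed
    have "kloosterman p r n a \<in> cyclotomic_subfield p (d * e) \<longleftrightarrow> (\<exists>s. \<omega> * a = a ^ (p ^ s))"
      using \<sigma>_fixes_iff[of a "M div e"] A by (simp add: E_eq[OF eM] Fix_def \<omega>_def)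
    also have "\<dots> \<longleftrightarrow> (\<exists>t u. t dvd r div e \<and> u \<in> {1..e - 1} \<and> gcd e u = 1 \<and>
            a \<in> (\<lambda>c. (\<gamma> ^ ((p ^ r - 1) div (e * (p ^ t - 1)))) ^ u * c) `
                  (finite_subfield p t - {0}))"
      by (rule frobenius_quotient_iff_coset[OF _ ep er _ \<omega>]) (use A in auto)
    finally show "kloosterman p r n a \<in> cyclotomic_subfield p (d * e) \<longleftrightarrow>
        (\<exists>t u. t dvd r div e \<and> u \<in> {1..e - 1} \<and> gcd e u = 1 \<and>
            a \<in> (\<lambda>c. (\<gamma> ^ ((p ^ r - 1) div (e * (p ^ t - 1)))) ^ u * c) `
                  (finite_subfield p t - {0}))" .
  qed
qed

end
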